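(* Let $p(n)\in(0,1)$ be a sequence for which there exists $\beta\in(6,\infty)$ such that $n^{-1}(\log n)^{\beta}\le p(n)<1-n^{-1}(\log n)^{\beta}$ for all sufficiently large $n$. For a simple graph on vertex set $[n]=\{1,\dots,n\}$, let $k_i$ be the degree of vertex $i$ and let $\lambda_1(n)$ be the largest eigenvalue of the adjacency matrix. For a given constraint, put $$\Delta_\infty=\lim_{n\to\infty}\Big(\mathbb{E}_{\mathrm{can}}[\lambda_1(n)]-\mathbb{E}_{\mathrm{mic}}[\lambda_1(n)]\Big),$$ where $\mathbb{E}_{\mathrm{mic}}$ and $\mathbb{E}_{\mathrm{can}}$ denote expectation under the microcanonical and the canonical ensemble with that constraint. (1) Let the constraint be $k_i=d(n)$ for all $i\in[n]$, with $d(n)\in\{0,\dots,n-1\}$, $n\,d(n)$ even, and $\lim_{n\to\infty}[n^{-1}d(n)]/p(n)=1$. Then the limit $\Delta_\infty$ exists and $$\Delta_\infty=\begin{cases}1-p, & \text{if } p(n)\equiv p\in(0,1),\\ 1, & \text{if } p(n)=o(1),\\ 0, & \text{if } p(n)=1-o(1).\end{cases}$$ (2) Let the constraint be $\tfrac12\sum_{i\in[n]}k_i=L(n)$, with $L(n)\in\{0,\dots,\binom n2\}$ and $\lim_{n\to\infty}[2n^{-2}L(n)]/p(n)=1$. Then the limit $\Delta_\infty$ exists and $\Delta_\infty=0$.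
   Context: Let $\mathbb{G}_n$ be the set of simple graphs on vertex set $[n]$. A constraint is a function $\vec C:\mathbb{G}_n\to\mathbb{R}^m$ together with a value $\vec C^\star$ that is attained by at least one graph; let $\Gamma_{\vec C^\star}=\{g\in\mathbb{G}_n:\vec C(g)=\vec C^\star\}$. The microcanonical ensemble $\mathbb{P}_{\mathrm{mic}}$ is the uniform distribution on $\Gamma_{\vec C^\star}$. The canonical ensemble is $\mathbb{P}_{\mathrm{can}}(g)=Z^{-1}e^{-\langle\vec\theta^\star,\vec C(g)\rangle}$, $g\in\mathbb{G}_n$, with $Z$ the normalising constant and $\vec\theta^\star$ chosen such that $\mathbb{E}_{\mathrm{can}}[\vec C]=\vec C^\star$. In case (1), $\mathbb{P}_{\mathrm{mic}}$ is the uniform distribution on $d(n)$-regular simple graphs on $[n]$, and $\mathbb{P}_{\mathrm{can}}$ is the law of the Erdős–Rényi random graph on $[n]$ with edge retention probability $d(n)/(n-1)$. In case (2), $\mathbb{P}_{\mathrm{mic}}$ is the uniform distribution on simple graphs on $[n]$ with exactly $L(n)$ edges, and $\mathbb{P}_{\mathrm{can}}$ is the law of the Erdős–Rényi random graph on $[n]$ with edge retention probability $L(n)/\binom n2$. (In degenerate cases where the retention probability is $0$ or $1$, the canonical ensemble is understood as this Erdős–Rényi law.) In case (1), $n$ and $d(n)$ are always such that $n\,d(n)$ is even. *)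

theory Defs
  imports
    "HOL-Probability.Probability"
    "HOL-Library.Ramsey"
    "Jordan_Normal_Form.Spectral_Radius"
begin

text \<open>A simple graph on $[n] = \{1,\dots,n\}$ is identified with its edge set, a set of
  two-element subsets of $[n]$.\<close>

type_synonym graph = "nat set set"

definition graphs :: "nat \<Rightarrow> graph set" where
  "graphs n = Pow (nsets {1..n} 2)"

definition vdegree :: "graph \<Rightarrow> nat \<Rightarrow> nat" where
  "vdegree g i = card {e \<in> g. i \<in> e}"

text \<open>Matrices are indexed from 0, so entry \<open>(i, j)\<close> belongs to the vertices \<open>i + 1\<close> and \<open>j + 1\<close>.
  For \<open>i = j\<close> the set \<open>{i + 1, j + 1}\<close> is a singleton, hence not an edge.\<close>

definition adjacency_matrix :: "nat \<Rightarrow> graph \<Rightarrow> real mat" where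
  "adjacency_matrix n g = mat n n (\<lambda>(i, j). if {i + 1, j + 1} \<in> g then 1 else 0)"

definition largest_eigenvalue :: "nat \<Rightarrow> graph \<Rightarrow> real" where
  "largest_eigenvalue n g = Max (spectrum (adjacency_matrix n g))"

text \<open>A constraint $\vec C : \mathbb{G}_n \to \mathbb{R}^m$ is a function
  \<open>C :: graph \<Rightarrow> nat \<Rightarrow> real\<close> of which only the components \<open>C g i\<close> with \<open>i \<in> {1..m}\<close> matter;
  likewise for its prescribed value \<open>c\<close> and for the parameter \<open>\<theta>\<close>.\<close>

definition microcanonical ::
    "nat \<Rightarrow> nat \<Rightarrow> (graph \<Rightarrow> nat \<Rightarrow> real) \<Rightarrow> (nat \<Rightarrow> real) \<Rightarrow> graph pmf" where
  "microcanonical n m C c = pmf_of_set {g \<in> graphs n. \<forall>i\<in>{1..m}. C g i = c i}"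

definition gibbs_weight ::
    "nat \<Rightarrow> (graph \<Rightarrow> nat \<Rightarrow> real) \<Rightarrow> (nat \<Rightarrow> real) \<Rightarrow> graph \<Rightarrow> real" where
  "gibbs_weight m C \<theta> g = exp (- (\<Sum>i\<in>{1..m}. \<theta> i * C g i))"

definition gibbs ::
    "nat \<Rightarrow> nat \<Rightarrow> (graph \<Rightarrow> nat \<Rightarrow> real) \<Rightarrow> (nat \<Rightarrow> real) \<Rightarrow> graph pmf" where
  "gibbs n m C \<theta> = embed_pmf (\<lambda>g. if g \<in> graphs n
     then gibbs_weight m C \<theta> g / (\<Sum>h\<in>graphs n. gibbs_weight m C \<theta> h) else 0)"

text \<open>The parameter \<open>\<theta>\<close> need not be unique, but any two admissible choices give the same
  distribution.\<close>

definition canonical ::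
    "nat \<Rightarrow> nat \<Rightarrow> (graph \<Rightarrow> nat \<Rightarrow> real) \<Rightarrow> (nat \<Rightarrow> real) \<Rightarrow> graph pmf" where
  "canonical n m C c = gibbs n m C
     (SOME \<theta>. \<forall>i\<in>{1..m}. measure_pmf.expectation (gibbs n m C \<theta>) (\<lambda>g. C g i) = c i)"

definition erdos_renyi :: "nat \<Rightarrow> real \<Rightarrow> graph pmf" where
  "erdos_renyi n q = map_pmf (\<lambda>X. {e \<in> nsets {1..n} 2. X e})
     (Pi_pmf (nsets {1..n} 2) False (\<lambda>_. bernoulli_pmf q))"

definition degree_constraint :: "graph \<Rightarrow> nat \<Rightarrow> real" where
  "degree_constraint g i = real (vdegree g i)"

definition edge_constraint :: "nat \<Rightarrow> graph \<Rightarrow> nat \<Rightarrow> real" where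
  "edge_constraint n g _ = 1/2 * (\<Sum>i\<in>{1..n}. real (vdegree g i))"

definition mic_regular :: "nat \<Rightarrow> nat \<Rightarrow> graph pmf" where
  "mic_regular n d = microcanonical n n degree_constraint (\<lambda>_. real d)"

definition mic_edges :: "nat \<Rightarrow> nat \<Rightarrow> graph pmf" where
  "mic_edges n L = microcanonical n 1 (edge_constraint n) (\<lambda>_. real L)"

text \<open>If the constraint forces the empty or the complete graph, no finite \<open>\<theta>\<close> is admissible and
  the canonical ensemble is by convention the (deterministic) Erdos-Renyi law.\<close>

definition can_regular :: "nat \<Rightarrow> nat \<Rightarrow> graph pmf" where
  "can_regular n d = (let q = real d / (real n - 1) in
     if q = 0 \<or> q = 1 then erdos_renyi n q
     else canonical n n degree_constraint (\<lambda>_. real d))"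

definition can_edges :: "nat \<Rightarrow> nat \<Rightarrow> graph pmf" where
  "can_edges n L = (let q = real L / real (n choose 2) in
     if q = 0 \<or> q = 1 then erdos_renyi n q
     else canonical n 1 (edge_constraint n) (\<lambda>_. real L))"

definition eigenvalue_gap :: "nat \<Rightarrow> graph pmf \<Rightarrow> graph pmf \<Rightarrow> real" where
  "eigenvalue_gap n Pcan Pmic =
     measure_pmf.expectation Pcan (largest_eigenvalue n)
     - measure_pmf.expectation Pmic (largest_eigenvalue n)"

lemma finite_graphs: "finite (graphs n)"
  by (simp add: graphs_def finite_imp_finite_nsets)

lemma pmf_gibbs:
  "pmf (gibbs n m C \<theta>) g = (if g \<in> graphs n
     then gibbs_weight m C \<theta> g / (\<Sum>h\<in>graphs n. gibbs_weight m C \<theta> h) else 0)"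
proof -
  let ?Z = "\<Sum>h\<in>graphs n. gibbs_weight m C \<theta> h"
  let ?f = "\<lambda>g. if g \<in> graphs n then gibbs_weight m C \<theta> g / ?Z else 0"
  have "graphs n \<noteq> {}"
    by (auto simp: graphs_def)
  then have Z: "?Z > 0"
    using finite_graphs by (intro sum_pos) (auto simp: gibbs_weight_def)
  have nn: "?f g \<ge> 0" for g
    using Z by (auto simp: gibbs_weight_def)
  have "(\<integral>\<^sup>+ g. ennreal (?f g) \<partial>count_space UNIV)
      = (\<integral>\<^sup>+ g. ennreal (?f g) \<partial>count_space (graphs n))"
    by (intro nn_integral_count_space_eq) auto
  also have "\<dots> = (\<Sum>g\<in>graphs n. ennreal (?f g))"
    by (simp add: nn_integral_count_space_finite finite_graphs)
  also have "\<dots> = ennreal (\<Sum>g\<in>graphs n. ?f g)"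
    by (rule sum_ennreal) (rule nn)
  also have "(\<Sum>g\<in>graphs n. ?f g) = 1"
    using Z by (simp add: sum_divide_distrib[symmetric])
  finally have one: "(\<integral>\<^sup>+ g. ennreal (?f g) \<partial>count_space UNIV) = 1"
    by simp
  show ?thesis
    unfolding gibbs_def by (rule pmf_embed_pmf[OF nn one])
qed

end

theory Submission
  imports Defs "HOL-Real_Asymp.Real_Asymp"
begin

text \<open>Write $k_i$ for the degrees, $\bar k$ for their mean and $\sigma^2$ for their empirical variance
  in a graph with adjacency matrix $A$, and suppose that $\|A - q(J - I)\| \le h$ with $h = o(D)$,
  $D = (n-1)q$. Decomposing vectors into their mean and a part orthogonal to the constants gives
  $\lambda_1 \le \bar k + \sigma^2/(\bar k - h)$, and the Rayleigh quotient of $1 + (k - \bar k)/D$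
  gives a matching lower bound, so that $\lambda_1 = \bar k + (1 + o(1))\,\sigma^2/D$. Both $\bar k$ and
  $\sigma^2$ have expectations that depend only on the probabilities that one or two given edges
  are present; hence $E\lambda_1 = D + (1 - q) + o(1)$ for the Erdos--Renyi graph as well as for the
  uniform graph with $L$ edges, whereas $\lambda_1 = d$ for a $d$-regular graph. The norm is bounded
  by the trace of a power of order $\log n$; under the uniform law with $L$ edges an event is at
  most $\binom n2 + 1$ times as likely as in the Erdos--Renyi graph, because $L$ is the mode of the
  number of edges there. The canonical ensembles are Erdos--Renyi laws because a Gibbs
  distribution is determined by the expected values of its constraints.\<close>

section \<open>Maximisers of quadratic forms\<close>

text \<open>The gap between the expectations is of order one while D grows, so D has to cancel
  exactly. This is why the bounds on the eigenvalue are linear in \<open>mean_deg\<close> and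
  \<open>deg_var\<close>, whose expectations are known without error; fluctuations of the mean
  degree then do no harm, and concentration enters only through the norm of the centred matrix.
  Since \<sigma>^2 / D has expectation at most 1, a relative error o(1) in its coefficient suffices.
  Hence the crude choice h = D / ln n, well above the true order of the norm, and a walk count
  without any combinatorics of trees: the trace method yields norms of order sqrt (D ln n), which
  stays below h once D is of order (ln n)^6. Expectations are compared, not typical values, so
  exceptional graphs must be polynomially rare: probability n^-9 for independent edges becomes n^-7
  after the change of measure and n^-5 after weighting with the trivial bound n^2. The test vector
  of the lower bound is in essence one step of power iteration from the constants, whose image under
  A is the degree vector.\<close>

lemma compact_box_nat:
  fixes S :: "'a \<Rightarrow> real set"
  assumes "\<And>i. compact (S i)"
  shows "compact {x :: 'a \<Rightarrow> real. \<forall>i. x i \<in> S i}"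
proof -
  have "compactin (product_topology (\<lambda>_. euclidean) (UNIV :: 'a set)) (PiE UNIV S)"
    using assms by (simp add: compactin_PiE compactin_euclidean_iff)
  moreover have "PiE UNIV S = {x. \<forall>i. x i \<in> S i}"
    by auto
  ultimately show ?thesis
    by (simp add: euclidean_product_topology compactin_euclidean_iff)
qed

lemma maximize_quadratic_form:
  fixes a :: "'a \<Rightarrow> 'a \<Rightarrow> real"
  assumes fin: "finite V" and ne: "V \<noteq> {}"
  obtains u where "(\<Sum>i\<in>V. (u i)\<^sup>2) = 1"
    and "\<And>x. (\<Sum>i\<in>V. \<Sum>j\<in>V. a i j * x i * x j)
      \<le> (\<Sum>i\<in>V. \<Sum>j\<in>V. a i j * u i * u j) * (\<Sum>i\<in>V. (x i)\<^sup>2)"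
proof -
  define Q where "Q x = (\<Sum>i\<in>V. \<Sum>j\<in>V. a i j * x i * x j)" for x :: "'a \<Rightarrow> real"
  define N where "N x = (\<Sum>i\<in>V. (x i)\<^sup>2)" for x :: "'a \<Rightarrow> real"
  \<comment> \<open>Vectors are functions on a whole type, so normalising the coordinates in V alone
    does not give a compact set. Pinning the other coordinates to 0 places the unit sphere inside a
    compact box.\<close>
  define B where "B = {x :: 'a \<Rightarrow> real. \<forall>i. x i \<in> (if i \<in> V then {-1..1} else {0})}"
  define S where "S = B \<inter> {x. N x = 1}"
  have coord: "continuous_on UNIV (\<lambda>x :: 'a \<Rightarrow> real. x i)" for i
    by (rule continuous_on_product_coordinates)
  have "closed {x. N x = 1}"
    unfolding N_def by (intro closed_Collect_eq continuous_intros coord)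
  moreover have "compact B"
    unfolding B_def by (intro compact_box_nat) auto
  ultimately have cS: "compact S"
    unfolding S_def by (rule compact_Int_closed[rotated])
  have cQ: "continuous_on S Q"
    unfolding Q_def
    by (rule continuous_on_subset[of UNIV]) (intro continuous_intros coord, simp)
  obtain i0 where i0: "i0 \<in> V" using ne by auto
  have "N (\<lambda>i. if i = i0 then 1 else 0) = 1"
    using fin i0 by (simp add: N_def if_distrib[of "\<lambda>t. t\<^sup>2"] cong: if_cong)
  then have "(\<lambda>i. if i = i0 then 1 else 0) \<in> S"
    using i0 by (auto simp: S_def B_def)
  then obtain u where u: "u \<in> S" and max: "\<And>y. y \<in> S \<Longrightarrow> Q y \<le> Q u"
    using continuous_attains_sup[OF cS _ cQ] by blast
  have "Q x \<le> Q u * N x" for x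
  proof (cases "N x = 0")
    case True
    then have "x i = 0" if "i \<in> V" for i
      using fin that by (simp add: N_def sum_nonneg_eq_0_iff)
    then have "Q x = 0"
      by (simp add: Q_def)
    then show ?thesis using True by simp
  next
    case False
    then have pos: "N x > 0"
      by (simp add: N_def sum_nonneg less_le)
    define c where "c = sqrt (N x)"
    have c: "c > 0" "c\<^sup>2 = N x"
      using pos by (auto simp: c_def)
    define y where "y i = (if i \<in> V then x i / c else 0)" for i
    have Ny: "N y = 1"
    proof -
      have "N y = N x / c\<^sup>2"
        by (simp add: N_def y_def power_divide sum_divide_distrib)
      then show ?thesis using c pos by simp
    qed
    have "y i \<in> {-1..1}" if "i \<in> V" for i
    proof -
      have "(y i)\<^sup>2 \<le> N y"
        unfolding N_def using fin that by (intro member_le_sum) auto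
      then have "\<bar>y i\<bar> \<le> 1"
        by (simp add: Ny abs_square_le_1)
      then show ?thesis by auto
    qed
    then have "y \<in> S"
      using Ny by (auto simp: S_def B_def y_def)
    from max[OF this] have "Q y \<le> Q u" .
    moreover have "Q y = Q x / c\<^sup>2"
      by (simp add: Q_def y_def sum_divide_distrib power2_eq_square)
    ultimately show ?thesis
      using c pos by (simp add: pos_divide_le_eq)
  qed
  moreover have "N u = 1"
    using u by (simp add: S_def)
  ultimately show ?thesis
    using that unfolding Q_def N_def by blast
qed

text \<open>First-order condition at the maximum. The inequality is an equality at u; moving u by t
  times the residual y = \<mu> u - a u changes its slack to \<open>2 * t * s + t\<^sup>2 * c\<close>
  with s = |y|^2, which would be negative for small negative t unless y = 0.\<close>

lemma maximizer_eigenvector: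
  fixes a :: "'a \<Rightarrow> 'a \<Rightarrow> real"
  assumes fin: "finite V" and sym: "\<And>i j. a i j = a j i"
    and unit: "(\<Sum>i\<in>V. (u i)\<^sup>2) = 1"
    and max: "\<And>x. (\<Sum>i\<in>V. \<Sum>j\<in>V. a i j * x i * x j)
      \<le> (\<Sum>i\<in>V. \<Sum>j\<in>V. a i j * u i * u j) * (\<Sum>i\<in>V. (x i)\<^sup>2)"
    and i: "i \<in> V"
  shows "(\<Sum>j\<in>V. a i j * u j) = (\<Sum>i\<in>V. \<Sum>j\<in>V. a i j * u i * u j) * u i"
proof -
  define \<mu> where "\<mu> = (\<Sum>i\<in>V. \<Sum>j\<in>V. a i j * u i * u j)"
  define y where "y i = \<mu> * u i - (\<Sum>j\<in>V. a i j * u j)" for i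
  define s where "s = (\<Sum>i\<in>V. (y i)\<^sup>2)"
  define c where "c = \<mu> * s - (\<Sum>i\<in>V. \<Sum>j\<in>V. a i j * y i * y j)"
  have c0: "c \<ge> 0"
    using max[of y] by (simp add: c_def s_def \<mu>_def)
  have ineq: "0 \<le> 2 * t * s + t\<^sup>2 * c" for t
  proof -
    have n: "(\<Sum>i\<in>V. (u i + t * y i)\<^sup>2) = 1 + 2 * t * (\<Sum>i\<in>V. u i * y i) + t\<^sup>2 * s"
    proof -
      have "(\<Sum>i\<in>V. (u i + t * y i)\<^sup>2)
          = (\<Sum>i\<in>V. (u i)\<^sup>2 + 2 * t * (u i * y i) + t\<^sup>2 * (y i)\<^sup>2)"
        by (intro sum.cong) (auto simp: power2_eq_square algebra_simps)
      then show ?thesis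
        by (simp add: sum.distrib sum_distrib_left[symmetric] unit s_def)
    qed
    have cross: "(\<Sum>i\<in>V. \<Sum>j\<in>V. a i j * y i * u j) = (\<Sum>i\<in>V. \<Sum>j\<in>V. a i j * u i * y j)"
      by (subst sum.swap) (auto intro!: sum.cong simp: sym)
    have q: "(\<Sum>i\<in>V. \<Sum>j\<in>V. a i j * (u i + t * y i) * (u j + t * y j))
       = \<mu> + 2 * t * (\<Sum>i\<in>V. \<Sum>j\<in>V. a i j * y i * u j)
         + t\<^sup>2 * (\<Sum>i\<in>V. \<Sum>j\<in>V. a i j * y i * y j)"
    proof -
      have "(\<Sum>i\<in>V. \<Sum>j\<in>V. a i j * (u i + t * y i) * (u j + t * y j))
        = (\<Sum>i\<in>V. \<Sum>j\<in>V. a i j * u i * u j + t * (a i j * u i * y j)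
            + t * (a i j * y i * u j) + t\<^sup>2 * (a i j * y i * y j))"
        by (intro sum.cong) (auto simp: power2_eq_square algebra_simps)
      then show ?thesis
        by (simp add: sum.distrib sum_distrib_left[symmetric] cross \<mu>_def)
    qed
    have yy: "s = \<mu> * (\<Sum>i\<in>V. u i * y i) - (\<Sum>i\<in>V. \<Sum>j\<in>V. a i j * y i * u j)"
    proof -
      have "y i * y i = \<mu> * (u i * y i) - (\<Sum>j\<in>V. a i j * y i * u j)" for i
        by (subst (2) y_def) (simp add: algebra_simps sum_distrib_left)
      then have "s = (\<Sum>i\<in>V. \<mu> * (u i * y i) - (\<Sum>j\<in>V. a i j * y i * u j))"
        by (simp add: s_def power2_eq_square)
      then show ?thesis
        by (simp add: sum_subtractf sum_distrib_left)
    qed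
    have "2 * t * s = \<mu> * (2 * t * (\<Sum>i\<in>V. u i * y i)) - 2 * t * (\<Sum>i\<in>V. \<Sum>j\<in>V. a i j * y i * u j)"
      by (subst yy) (simp only: right_diff_distrib mult.assoc mult.left_commute)
    moreover have "t\<^sup>2 * c = \<mu> * (t\<^sup>2 * s) - t\<^sup>2 * (\<Sum>i\<in>V. \<Sum>j\<in>V. a i j * y i * y j)"
      by (simp only: c_def right_diff_distrib mult.left_commute)
    ultimately show ?thesis
      using max[of "\<lambda>i. u i + t * y i"]
      unfolding n q \<mu>_def[symmetric]
      unfolding distrib_left mult_1_right by linarith
  qed
  have "s = 0"
  proof (rule ccontr)
    assume "s \<noteq> 0"
    then have s: "s > 0" by (simp add: s_def sum_nonneg less_le)
    \<comment> \<open>Any t > 0 with t c < 2 s would do; dividing by c + 1 instead of c covers the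
      case c = 0.\<close>
    define t where "t = s / (c + 1)"
    have t: "t > 0" "s = t * (c + 1)"
      using s c0 by (auto simp: t_def)
    have "2 * (- t) * s + (- t)\<^sup>2 * c = - (t\<^sup>2 * (c + 2))"
      unfolding t(2) by (simp add: algebra_simps power2_eq_square)
    moreover have "t\<^sup>2 * (c + 2) > 0"
      using t c0 by simp
    ultimately show False using ineq[of "- t"] by linarith
  qed
  then have "y i = 0"
    using fin i by (simp add: s_def sum_nonneg_eq_0_iff)
  then show ?thesis by (simp add: y_def \<mu>_def)
qed

section \<open>The largest eigenvalue as a maximum of Rayleigh quotients\<close>

text \<open>Indexed by the vertices themselves, so that the index shift of
  \<open>adjacency_matrix\<close> is confined to the lemmas about its spectrum.\<close>

definition adj :: "graph \<Rightarrow> nat \<Rightarrow> nat \<Rightarrow> real" where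
  "adj g i j = (if {i, j} \<in> g then 1 else 0)"

lemma adj_sym: "adj g i j = adj g j i"
  by (simp add: adj_def insert_commute)

lemma sum_atLeast1_shift: "(\<Sum>j\<in>{0..<n}. f (Suc j)) = (\<Sum>j\<in>{1..n}. f j)"
  by (rule sum.reindex_bij_witness[of _ "\<lambda>j. j - 1" Suc]) auto

lemma adjacency_matrix_mult_vec:
  assumes "i < n" "v \<in> carrier_vec n"
  shows "vec_index (adjacency_matrix n g *\<^sub>v v) i = (\<Sum>j\<in>{1..n}. adj g (Suc i) j * vec_index v (j - 1))"
proof -
  have "vec_index (adjacency_matrix n g *\<^sub>v v) i
      = (\<Sum>j\<in>{0..<n}. adj g (Suc i) (Suc j) * vec_index v (Suc j - 1))"
    using assms by (auto simp: adjacency_matrix_def scalar_prod_def adj_def intro!: sum.cong)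
  then show ?thesis
    using sum_atLeast1_shift[of "\<lambda>j. adj g (Suc i) j * vec_index v (j - 1)" n] by simp
qed

lemma spectrum_adjacency_iff:
  "\<mu> \<in> spectrum (adjacency_matrix n g) \<longleftrightarrow>
     (\<exists>u. (\<exists>i\<in>{1..n}. u i \<noteq> 0) \<and> (\<forall>i\<in>{1..n}. (\<Sum>j\<in>{1..n}. adj g i j * u j) = \<mu> * u i))"
proof
  assume "\<mu> \<in> spectrum (adjacency_matrix n g)"
  then obtain v where v: "v \<in> carrier_vec n" "v \<noteq> 0\<^sub>v n"
      and ev: "adjacency_matrix n g *\<^sub>v v = \<mu> \<cdot>\<^sub>v v"
    by (auto simp: spectrum_def eigenvalue_def eigenvector_def adjacency_matrix_def)
  from v have "\<exists>k<n. vec_index v k \<noteq> 0"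
    by (metis carrier_vecD eq_vecI index_zero_vec(1) index_zero_vec(2))
  then obtain k where k: "k < n" "vec_index v k \<noteq> 0" by blast
  have "(\<Sum>j\<in>{1..n}. adj g i j * vec_index v (j - 1)) = \<mu> * vec_index v (i - 1)" if "i \<in> {1..n}" for i
  proof -
    have "i - 1 < n" "Suc (i - 1) = i" using that by auto
    then show ?thesis
      using adjacency_matrix_mult_vec[of "i - 1" n v g] v ev by simp
  qed
  then show "\<exists>u. (\<exists>i\<in>{1..n}. u i \<noteq> 0) \<and> (\<forall>i\<in>{1..n}. (\<Sum>j\<in>{1..n}. adj g i j * u j) = \<mu> * u i)"
    using k by (intro exI[of _ "\<lambda>j. vec_index v (j - 1)"]) (auto intro!: bexI[of _ "Suc k"])
next
  assume "\<exists>u. (\<exists>i\<in>{1..n}. u i \<noteq> 0) \<and> (\<forall>i\<in>{1..n}. (\<Sum>j\<in>{1..n}. adj g i j * u j) = \<mu> * u i)"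
  then obtain u k where k: "k \<in> {1..n}" "u k \<noteq> 0"
    and ev: "\<And>i. i \<in> {1..n} \<Longrightarrow> (\<Sum>j\<in>{1..n}. adj g i j * u j) = \<mu> * u i" by blast
  define v where "v = Matrix.vec n (\<lambda>i. u (Suc i))"
  have v: "v \<in> carrier_vec n" by (simp add: v_def)
  have "v \<noteq> 0\<^sub>v n"
  proof
    assume "v = 0\<^sub>v n"
    have "k - 1 < n" using k by auto
    with \<open>v = 0\<^sub>v n\<close> have "vec_index v (k - 1) = 0" by (metis index_zero_vec(1))
    moreover have "vec_index v (k - 1) = u k" using k \<open>k - 1 < n\<close> by (simp add: v_def)
    ultimately show False using k by simp
  qed
  moreover have "adjacency_matrix n g *\<^sub>v v = \<mu> \<cdot>\<^sub>v v"
  proof (rule eq_vecI)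
    fix i assume "i < dim_vec (\<mu> \<cdot>\<^sub>v v)"
    then have i: "i < n" by (simp add: v_def)
    have "vec_index (adjacency_matrix n g *\<^sub>v v) i = (\<Sum>j\<in>{1..n}. adj g (Suc i) j * u j)"
      using i v by (subst adjacency_matrix_mult_vec) (auto simp: v_def intro!: sum.cong)
    also have "\<dots> = \<mu> * u (Suc i)" using i by (intro ev) auto
    finally show "vec_index (adjacency_matrix n g *\<^sub>v v) i = vec_index (\<mu> \<cdot>\<^sub>v v) i"
      using i by (simp add: v_def)
  qed (simp add: adjacency_matrix_def v_def)
  ultimately show "\<mu> \<in> spectrum (adjacency_matrix n g)"
    using v unfolding spectrum_def eigenvalue_def eigenvector_def
    by (auto simp: adjacency_matrix_def)
qed

text \<open>Takes the place of the spectral theorem: a single eigenvalue dominating the quadratic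
  form is enough, and the maximiser supplies it. For n = 0 the spectrum is empty.\<close>

lemma adjacency_eigenvalue_attains_max:
  assumes "n \<ge> 1"
  obtains \<mu> where "\<mu> \<in> spectrum (adjacency_matrix n g)"
    and "\<And>x. (\<Sum>i\<in>{1..n}. \<Sum>j\<in>{1..n}. adj g i j * x i * x j) \<le> \<mu> * (\<Sum>i\<in>{1..n}. (x i)\<^sup>2)"
proof -
  obtain u where u: "(\<Sum>i\<in>{1..n}. (u i)\<^sup>2) = 1"
    and max: "\<And>x. (\<Sum>i\<in>{1..n}. \<Sum>j\<in>{1..n}. adj g i j * x i * x j)
      \<le> (\<Sum>i\<in>{1..n}. \<Sum>j\<in>{1..n}. adj g i j * u i * u j) * (\<Sum>i\<in>{1..n}. (x i)\<^sup>2)"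
    using maximize_quadratic_form[of "{1..n}" "adj g"] assms by auto
  define \<mu> where "\<mu> = (\<Sum>i\<in>{1..n}. \<Sum>j\<in>{1..n}. adj g i j * u i * u j)"
  have "(\<Sum>j\<in>{1..n}. adj g i j * u j) = \<mu> * u i" if "i \<in> {1..n}" for i
    unfolding \<mu>_def by (rule maximizer_eigenvector[OF _ adj_sym u max that]) auto
  moreover have "\<exists>i\<in>{1..n}. u i \<noteq> 0"
  proof (rule ccontr)
    assume "\<not> (\<exists>i\<in>{1..n}. u i \<noteq> 0)"
    then have "(\<Sum>i\<in>{1..n}. (u i)\<^sup>2) = 0" by simp
    then show False using u by simp
  qed
  ultimately have "\<mu> \<in> spectrum (adjacency_matrix n g)"
    unfolding spectrum_adjacency_iff by blast
  then show ?thesis using that max unfolding \<mu>_def by blast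
qed

lemma finite_spectrum_adjacency: "finite (spectrum (adjacency_matrix n g))"
  by (rule card_finite_spectrum(1)[of _ n]) (simp add: adjacency_matrix_def)

lemma quadratic_form_le_largest_eigenvalue:
  assumes "n \<ge> 1"
  shows "(\<Sum>i\<in>{1..n}. \<Sum>j\<in>{1..n}. adj g i j * x i * x j)
    \<le> largest_eigenvalue n g * (\<Sum>i\<in>{1..n}. (x i)\<^sup>2)"
proof -
  obtain \<mu> where mem: "\<mu> \<in> spectrum (adjacency_matrix n g)"
    and max: "\<And>x. (\<Sum>i\<in>{1..n}. \<Sum>j\<in>{1..n}. adj g i j * x i * x j) \<le> \<mu> * (\<Sum>i\<in>{1..n}. (x i)\<^sup>2)"
    using adjacency_eigenvalue_attains_max[OF assms] by blast
  have "\<mu> \<le> largest_eigenvalue n g"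
    unfolding largest_eigenvalue_def using mem finite_spectrum_adjacency by (intro Max_ge)
  then have "\<mu> * (\<Sum>i\<in>{1..n}. (x i)\<^sup>2) \<le> largest_eigenvalue n g * (\<Sum>i\<in>{1..n}. (x i)\<^sup>2)"
    by (intro mult_right_mono sum_nonneg) auto
  with max[of x] show ?thesis by linarith
qed

lemma largest_eigenvalue_le:
  assumes n: "n \<ge> 1"
    and bound: "\<And>x. (\<Sum>i\<in>{1..n}. \<Sum>j\<in>{1..n}. adj g i j * x i * x j) \<le> B * (\<Sum>i\<in>{1..n}. (x i)\<^sup>2)"
  shows "largest_eigenvalue n g \<le> B"
proof -
  have ne: "spectrum (adjacency_matrix n g) \<noteq> {}"
    using adjacency_eigenvalue_attains_max[OF n] by blast
  have "largest_eigenvalue n g \<in> spectrum (adjacency_matrix n g)"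
    unfolding largest_eigenvalue_def by (rule Max_in[OF finite_spectrum_adjacency ne])
  then obtain u k where k: "k \<in> {1..n}" "u k \<noteq> 0"
    and ev: "\<And>i. i \<in> {1..n} \<Longrightarrow> (\<Sum>j\<in>{1..n}. adj g i j * u j) = largest_eigenvalue n g * u i"
    unfolding spectrum_adjacency_iff by blast
  have "(\<Sum>i\<in>{1..n}. \<Sum>j\<in>{1..n}. adj g i j * u i * u j)
      = (\<Sum>i\<in>{1..n}. u i * (\<Sum>j\<in>{1..n}. adj g i j * u j))"
    by (simp add: sum_distrib_left mult_ac)
  also have "\<dots> = (\<Sum>i\<in>{1..n}. largest_eigenvalue n g * (u i)\<^sup>2)"
  proof (rule sum.cong)
    show "u i * (\<Sum>j\<in>{1..n}. adj g i j * u j) = largest_eigenvalue n g * (u i)\<^sup>2" if "i \<in> {1..n}" for i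
      unfolding ev[OF that] by (simp add: power2_eq_square)
  qed simp
  finally have "largest_eigenvalue n g * (\<Sum>i\<in>{1..n}. (u i)\<^sup>2) \<le> B * (\<Sum>i\<in>{1..n}. (u i)\<^sup>2)"
    using bound[of u] by (simp add: sum_distrib_left)
  moreover have "(\<Sum>i\<in>{1..n}. (u i)\<^sup>2) > 0"
    using k by (intro sum_pos2[of _ k]) auto
  ultimately show ?thesis by simp
qed

section \<open>Operator norm and traces of powers\<close>

text \<open>With matrices acting on functions, matrix powers are iterates \<open>^^\<close>, which
  later unfold directly into sums over walks.\<close>

definition mat_op :: "'a set \<Rightarrow> ('a \<Rightarrow> 'a \<Rightarrow> real) \<Rightarrow> ('a \<Rightarrow> real) \<Rightarrow> 'a \<Rightarrow> real" where
  "mat_op V a x i = (\<Sum>j\<in>V. a i j * x j)"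

definition trace_pow :: "'a set \<Rightarrow> ('a \<Rightarrow> 'a \<Rightarrow> real) \<Rightarrow> nat \<Rightarrow> real" where
  "trace_pow V a k = (\<Sum>i\<in>V. (mat_op V a ^^ k) (\<lambda>j. if j = i then 1 else 0) i)"

lemma mat_op_self_adjoint:
  assumes "\<And>i j. a i j = a j i"
  shows "(\<Sum>i\<in>V. mat_op V a x i * y i) = (\<Sum>i\<in>V. x i * mat_op V a y i)"
proof -
  have "(\<Sum>i\<in>V. mat_op V a x i * y i) = (\<Sum>i\<in>V. \<Sum>j\<in>V. a i j * x j * y i)"
    by (simp add: mat_op_def sum_distrib_right)
  also have "\<dots> = (\<Sum>j\<in>V. \<Sum>i\<in>V. a i j * x j * y i)"
    by (rule sum.swap)
  also have "\<dots> = (\<Sum>j\<in>V. x j * mat_op V a y j)"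
    using assms by (simp add: mat_op_def sum_distrib_left mult_ac)
  finally show ?thesis .
qed

lemma mat_op_pow_self_adjoint:
  assumes "\<And>i j. a i j = a j i"
  shows "(\<Sum>i\<in>V. (mat_op V a ^^ k) x i * y i) = (\<Sum>i\<in>V. x i * (mat_op V a ^^ k) y i)"
proof (induction k arbitrary: x y)
  case (Suc k)
  have "(\<Sum>i\<in>V. (mat_op V a ^^ Suc k) x i * y i) = (\<Sum>i\<in>V. (mat_op V a ^^ k) x i * mat_op V a y i)"
    using mat_op_self_adjoint[OF assms] by simp
  also have "\<dots> = (\<Sum>i\<in>V. x i * (mat_op V a ^^ Suc k) y i)"
    using Suc.IH by (simp add: funpow_swap1)
  finally show ?case .
qed simp

lemma mat_op_pow_add:
  assumes "\<And>i j. a i j = a j i"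
  shows "(\<Sum>i\<in>V. (mat_op V a ^^ k) x i * (mat_op V a ^^ l) y i)
    = (\<Sum>i\<in>V. x i * (mat_op V a ^^ (k + l)) y i)"
  by (simp add: mat_op_pow_self_adjoint[OF assms] funpow_add)

text \<open>Squaring repeatedly: by Cauchy--Schwarz,
  $\|a^k x\|^4 = \langle a^{2k}x, x\rangle^2 \le \|a^{2k}x\|^2\|x\|^2$.\<close>

lemma mat_op_norm_power:
  assumes "\<And>i j. a i j = a j i"
  shows "(\<Sum>i\<in>V. (mat_op V a x i)\<^sup>2) ^ (2 ^ r) * (\<Sum>i\<in>V. (x i)\<^sup>2)
    \<le> (\<Sum>i\<in>V. ((mat_op V a ^^ (2 ^ r)) x i)\<^sup>2) * (\<Sum>i\<in>V. (x i)\<^sup>2) ^ (2 ^ r)"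
proof (induction r)
  case (Suc r)
  define N where "N k = (\<Sum>i\<in>V. ((mat_op V a ^^ k) x i)\<^sup>2)" for k
  let ?k = "(2 :: nat) ^ r"
  have nn: "N k \<ge> 0" for k by (simp add: N_def sum_nonneg)
  have IH: "N 1 ^ ?k * N 0 \<le> N ?k * N 0 ^ ?k"
    using Suc by (simp add: N_def)
  have "(N ?k)\<^sup>2 = (\<Sum>i\<in>V. x i * (mat_op V a ^^ (2 * ?k)) x i)\<^sup>2"
    using mat_op_pow_add[where a = a, OF assms, where V = V and k = ?k and x = x and l = ?k and y = x] by (simp add: N_def power2_eq_square mult_2)
  also have "\<dots> \<le> N 0 * N (2 * ?k)"
    unfolding N_def using Cauchy_Schwarz_ineq_sum[of x "(mat_op V a ^^ (2 * ?k)) x" V] by simp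
  finally have sq: "(N ?k)\<^sup>2 \<le> N 0 * N (2 * ?k)" .
  show ?case
  proof (cases "N 0 = 0")
    case True
    then show ?thesis by (simp add: N_def power_0_left)
  next
    case False
    then have pos: "N 0 > 0" using nn[of 0] by simp
    \<comment> \<open>Squaring the induction hypothesis doubles the exponents but leaves one factor
      \<open>N 0\<close> too many on either side; the case distinction allows it to be
      cancelled.\<close>
    have "(N 1 ^ ?k * N 0)\<^sup>2 \<le> (N ?k * N 0 ^ ?k)\<^sup>2"
      using IH nn by (intro power_mono) auto
    also have "\<dots> \<le> N 0 * N (2 * ?k) * (N 0 ^ ?k)\<^sup>2"
      unfolding power_mult_distrib using sq nn by (intro mult_right_mono) auto
    finally have "N 0 * (N 1 ^ (2 * ?k) * N 0) \<le> N 0 * (N (2 * ?k) * N 0 ^ (2 * ?k))"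
      by (simp add: power_mult_distrib power_even_eq power2_eq_square mult_ac)
    then have "N 1 ^ (2 * ?k) * N 0 \<le> N (2 * ?k) * N 0 ^ (2 * ?k)"
      using pos by simp
    then show ?thesis by (simp add: N_def)
  qed
qed simp

text \<open>The Hilbert--Schmidt norm dominates the operator norm. Coordinate i of a^k x is the
  inner product of x with a^k e_i, and by symmetry |a^k e_i|^2 is the i-th diagonal entry of a^(2k);
  Cauchy--Schwarz and summation over i give the trace.\<close>

lemma mat_op_pow_norm_le_trace:
  fixes a :: "'a \<Rightarrow> 'a \<Rightarrow> real"
  assumes fin: "finite V" and sym: "\<And>i j. a i j = a j i"
  shows "(\<Sum>i\<in>V. ((mat_op V a ^^ k) x i)\<^sup>2) \<le> trace_pow V a (2 * k) * (\<Sum>i\<in>V. (x i)\<^sup>2)"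
proof -
  define e :: "'a \<Rightarrow> 'a \<Rightarrow> real" where "e = (\<lambda>i j. if j = i then 1 else 0)"
  have pick: "(\<Sum>j\<in>V. f j * e i j) = f i" "(\<Sum>j\<in>V. e i j * f j) = f i" if "i \<in> V" for i and f :: "'a \<Rightarrow> real"
    using fin that by (simp_all add: e_def if_distrib[of "\<lambda>t. t * _"] if_distrib[of "\<lambda>t. _ * t"] cong: if_cong)
  have "((mat_op V a ^^ k) x i)\<^sup>2 \<le> (mat_op V a ^^ (2 * k)) (e i) i * (\<Sum>i\<in>V. (x i)\<^sup>2)"
    if i: "i \<in> V" for i
  proof -
    have "(mat_op V a ^^ k) x i = (\<Sum>j\<in>V. x j * (mat_op V a ^^ k) (e i) j)"
      using mat_op_pow_self_adjoint[where a = a, OF sym, where V = V and k = k and x = x and y = "e i"] pick(1)[OF i] by simp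
    then have "((mat_op V a ^^ k) x i)\<^sup>2
        \<le> (\<Sum>i\<in>V. (x i)\<^sup>2) * (\<Sum>j\<in>V. ((mat_op V a ^^ k) (e i) j)\<^sup>2)"
      by (simp add: Cauchy_Schwarz_ineq_sum)
    also have "(\<Sum>j\<in>V. ((mat_op V a ^^ k) (e i) j)\<^sup>2) = (mat_op V a ^^ (2 * k)) (e i) i"
      using mat_op_pow_add[where a = a, OF sym, where V = V and k = k and x = "e i" and l = k and y = "e i"] pick(2)[OF i]
      by (simp add: power2_eq_square mult_2)
    finally show ?thesis by (simp add: mult.commute)
  qed
  then have "(\<Sum>i\<in>V. ((mat_op V a ^^ k) x i)\<^sup>2)
      \<le> (\<Sum>i\<in>V. (mat_op V a ^^ (2 * k)) (e i) i * (\<Sum>i\<in>V. (x i)\<^sup>2))"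
    by (intro sum_mono)
  then show ?thesis
    by (simp add: trace_pow_def e_def sum_distrib_right)
qed

text \<open>Markov's inequality for the trace requires this sign; it falls out of the preceding
  bound at the all-ones vector.\<close>

lemma trace_pow_even_nonneg:
  fixes a :: "'a \<Rightarrow> 'a \<Rightarrow> real"
  assumes fin: "finite V" and sym: "\<And>i j. a i j = a j i"
  shows "trace_pow V a (2 * k) \<ge> 0"
proof (cases "V = {}")
  case False
  then have "(\<Sum>i\<in>V. (1::real)\<^sup>2) > 0" using fin by (simp add: card_gt_0_iff)
  moreover have "0 \<le> trace_pow V a (2 * k) * (\<Sum>i\<in>V. (1::real)\<^sup>2)"
    using mat_op_pow_norm_le_trace[where a = a, OF fin sym, where k = k and x = "\<lambda>_. 1"]
    by (rule order_trans[rotated]) (simp add: sum_nonneg)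
  ultimately show ?thesis
    by (simp add: zero_le_mult_iff)
qed (simp add: trace_pow_def)

text \<open>The exponent is a power of two because one application of a is compared with many by
  repeated squaring only; no diagonalisation of a is involved.\<close>

lemma mat_op_norm_le:
  fixes a :: "'a \<Rightarrow> 'a \<Rightarrow> real"
  assumes fin: "finite V" and sym: "\<And>i j. a i j = a j i"
    and tr: "trace_pow V a (2 * 2 ^ r) \<le> h ^ (2 * 2 ^ r)"
  shows "(\<Sum>i\<in>V. (mat_op V a x i)\<^sup>2) \<le> h\<^sup>2 * (\<Sum>i\<in>V. (x i)\<^sup>2)"
proof -
  let ?k = "(2 :: nat) ^ r"
  define N0 where "N0 = (\<Sum>i\<in>V. (x i)\<^sup>2)"
  define N1 where "N1 = (\<Sum>i\<in>V. (mat_op V a x i)\<^sup>2)"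
  have nn: "N0 \<ge> 0" "N1 \<ge> 0" by (auto simp: N0_def N1_def sum_nonneg)
  show ?thesis
  proof (cases "N0 = 0")
    case True
    then have "x i = 0" if "i \<in> V" for i
      using fin that by (simp add: N0_def sum_nonneg_eq_0_iff)
    then show ?thesis by (simp add: mat_op_def)
  next
    case False
    then have pos: "N0 > 0" using nn by simp
    have "N1 ^ ?k * N0 \<le> (\<Sum>i\<in>V. ((mat_op V a ^^ ?k) x i)\<^sup>2) * N0 ^ ?k"
      using mat_op_norm_power[OF sym] by (simp add: N0_def N1_def)
    also have "\<dots> \<le> (h ^ (2 * ?k) * N0) * N0 ^ ?k"
    proof (rule mult_right_mono)
      have "trace_pow V a (2 * ?k) * N0 \<le> h ^ (2 * ?k) * N0"
        using tr nn(1) by (rule mult_right_mono)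
      with mat_op_pow_norm_le_trace[where a = a, OF fin sym, where k = ?k and x = x]
      show "(\<Sum>i\<in>V. ((mat_op V a ^^ ?k) x i)\<^sup>2) \<le> h ^ (2 * ?k) * N0"
        by (simp add: N0_def)
    qed (use nn in auto)
    finally have "N1 ^ ?k \<le> (h\<^sup>2 * N0) ^ ?k"
      using pos by (simp add: power_mult power_mult_distrib mult_ac)
    then have "N1 \<le> h\<^sup>2 * N0"
      using nn by (intro power_mono_iff[THEN iffD1, of N1 _ ?k]) auto
    then show ?thesis by (simp add: N0_def N1_def)
  qed
qed

lemma quadratic_form_abs_le:
  fixes a :: "'a \<Rightarrow> 'a \<Rightarrow> real"
  assumes "h \<ge> 0"
    and op: "\<And>x. (\<Sum>i\<in>V. (mat_op V a x i)\<^sup>2) \<le> h\<^sup>2 * (\<Sum>i\<in>V. (x i)\<^sup>2)"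
  shows "\<bar>\<Sum>i\<in>V. \<Sum>j\<in>V. a i j * x i * x j\<bar> \<le> h * (\<Sum>i\<in>V. (x i)\<^sup>2)"
proof -
  have "(\<Sum>i\<in>V. \<Sum>j\<in>V. a i j * x i * x j) = (\<Sum>i\<in>V. x i * mat_op V a x i)"
    by (simp add: mat_op_def sum_distrib_left mult_ac)
  also have "(\<dots>)\<^sup>2 \<le> (\<Sum>i\<in>V. (x i)\<^sup>2) * (\<Sum>i\<in>V. (mat_op V a x i)\<^sup>2)"
    by (rule Cauchy_Schwarz_ineq_sum)
  also have "\<dots> \<le> (\<Sum>i\<in>V. (x i)\<^sup>2) * (h\<^sup>2 * (\<Sum>i\<in>V. (x i)\<^sup>2))"
    by (intro mult_left_mono op sum_nonneg) auto
  also have "\<dots> = (h * (\<Sum>i\<in>V. (x i)\<^sup>2))\<^sup>2"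
    by (simp add: power2_eq_square)
  finally show ?thesis
    using assms(1) by (intro power2_le_imp_le[of "\<bar>_\<bar>"]) (auto intro!: mult_nonneg_nonneg sum_nonneg)
qed

section \<open>Largest eigenvalue and degree variance\<close>

declare One_nat_def [simp del]

definition deg :: "nat \<Rightarrow> graph \<Rightarrow> nat \<Rightarrow> real" where
  "deg n g i = (\<Sum>j\<in>{1..n}. adj g i j)"

definition mean_deg :: "nat \<Rightarrow> graph \<Rightarrow> real" where
  "mean_deg n g = (\<Sum>i\<in>{1..n}. deg n g i) / n"

definition deg_var :: "nat \<Rightarrow> graph \<Rightarrow> real" where
  "deg_var n g = (\<Sum>i\<in>{1..n}. (deg n g i - mean_deg n g)\<^sup>2) / n"

definition centred :: "real \<Rightarrow> graph \<Rightarrow> nat \<Rightarrow> nat \<Rightarrow> real" where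
  "centred q g i j = (if i = j then 0 else adj g i j - q)"

lemma deg_var_nonneg: "deg_var n g \<ge> 0"
  by (simp add: deg_var_def sum_nonneg)

lemma centred_sym: "centred q g i j = centred q g j i"
  by (simp add: centred_def adj_sym)

lemma adj_diag: "g \<in> graphs n \<Longrightarrow> adj g i i = 0"
  by (auto simp: adj_def graphs_def nsets_def)

lemma sum_deg: "n \<ge> 1 \<Longrightarrow> (\<Sum>i\<in>{1..n}. deg n g i) = n * mean_deg n g"
  by (simp add: mean_deg_def)

lemma quadratic_form_shift:
  "(\<Sum>i\<in>{1..n}. \<Sum>j\<in>{1..n}. adj g i j * (c + w i) * (c + w j))
    = c\<^sup>2 * (\<Sum>i\<in>{1..n}. deg n g i) + 2 * c * (\<Sum>i\<in>{1..n}. deg n g i * w i)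
      + (\<Sum>i\<in>{1..n}. \<Sum>j\<in>{1..n}. adj g i j * w i * w j)"
proof -
  have "(\<Sum>i\<in>{1..n}. \<Sum>j\<in>{1..n}. adj g i j * (c + w i) * (c + w j))
      = (\<Sum>i\<in>{1..n}. \<Sum>j\<in>{1..n}. c\<^sup>2 * adj g i j + c * (adj g i j * w i)
          + c * (adj g i j * w j) + adj g i j * w i * w j)"
    by (intro sum.cong refl) (simp add: power2_eq_square algebra_simps)
  moreover have "(\<Sum>i\<in>{1..n}. \<Sum>j\<in>{1..n}. adj g i j * w j) = (\<Sum>i\<in>{1..n}. \<Sum>j\<in>{1..n}. adj g i j * w i)"
    by (subst sum.swap) (simp add: adj_sym)
  ultimately show ?thesis
    by (simp add: sum.distrib sum_distrib_left[symmetric] deg_def sum_distrib_right)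
qed

text \<open>On vectors orthogonal to the constants q J vanishes and only
  \<open>- q * (\<Sum>i\<in>{1..n}. (w i)\<^sup>2)\<close> remains, caused by the zero diagonal. Its
  sign is favourable for the upper bound on the eigenvalue; in the lower bound it becomes the term
  \<open>q / D\<close>.\<close>

lemma quadratic_form_centred:
  assumes "g \<in> graphs n"
  shows "(\<Sum>i\<in>{1..n}. \<Sum>j\<in>{1..n}. adj g i j * w i * w j)
    = (\<Sum>i\<in>{1..n}. \<Sum>j\<in>{1..n}. centred q g i j * w i * w j)
      + q * (\<Sum>i\<in>{1..n}. w i)\<^sup>2 - q * (\<Sum>i\<in>{1..n}. (w i)\<^sup>2)"
proof -
  have "adj g i j * w i * w j
      = centred q g i j * w i * w j + q * (w i * w j) - q * (if j = i then (w i)\<^sup>2 else 0)" for i j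
    using adj_diag[OF assms] by (simp add: centred_def power2_eq_square algebra_simps)
  then have "(\<Sum>i\<in>{1..n}. \<Sum>j\<in>{1..n}. adj g i j * w i * w j)
      = (\<Sum>i\<in>{1..n}. \<Sum>j\<in>{1..n}. centred q g i j * w i * w j + q * (w i * w j)
          - q * (if j = i then (w i)\<^sup>2 else 0))"
    by (intro sum.cong refl)
  then show ?thesis
    by (simp add: sum.distrib sum_subtractf sum_distrib_left[symmetric] power2_eq_square sum_product)
qed

lemma mat_op_centred_one:
  fixes q :: real
  assumes "g \<in> graphs n" "i \<in> {1..n}"
  shows "mat_op {1..n} (centred q g) (\<lambda>_. 1) i = deg n g i - q * (n - 1)"
proof -
  have "centred q g i j = adj g i j - q + (if j = i then q else 0)" for j
    using adj_diag[OF assms(1)] by (simp add: centred_def)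
  then have "mat_op {1..n} (centred q g) (\<lambda>_. 1) i
      = (\<Sum>j\<in>{1..n}. adj g i j - q + (if j = i then q else 0))"
    by (simp add: mat_op_def)
  then show ?thesis
    using assms(2) by (simp add: sum.distrib sum_subtractf deg_def algebra_simps of_nat_diff)
qed

lemma mean_deg_le_largest_eigenvalue:
  assumes "n \<ge> 1"
  shows "mean_deg n g \<le> largest_eigenvalue n g"
proof -
  have "n * mean_deg n g \<le> largest_eigenvalue n g * n"
    using quadratic_form_le_largest_eigenvalue[OF assms, of g "\<lambda>_. 1"] assms
    by (simp add: deg_def[symmetric] mean_deg_def)
  then show ?thesis using assms by (simp add: mult.commute)
qed

lemma deg_nonneg: "0 \<le> deg n g i"
  by (simp add: deg_def adj_def sum_nonneg)

text \<open>Apply 2 x_i x_j <= x_i^2 + x_j^2 to every edge. This yields both the crude bound n for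
  exceptional graphs and the exact value for regular ones.\<close>

lemma largest_eigenvalue_le_max_deg:
  assumes n: "n \<ge> 1" and d: "\<And>i. i \<in> {1..n} \<Longrightarrow> deg n g i \<le> d"
  shows "largest_eigenvalue n g \<le> d"
proof (rule largest_eigenvalue_le[OF n])
  fix x :: "nat \<Rightarrow> real"
  have *: "adj g i j * x i * x j \<le> adj g i j * (x i)\<^sup>2 / 2 + adj g i j * (x j)\<^sup>2 / 2" for i j
    using sum_squares_bound[of "x i" "x j"] by (simp add: adj_def)
  have "(\<Sum>i\<in>{1..n}. \<Sum>j\<in>{1..n}. adj g i j * x i * x j)
      \<le> (\<Sum>i\<in>{1..n}. \<Sum>j\<in>{1..n}. adj g i j * (x i)\<^sup>2 / 2 + adj g i j * (x j)\<^sup>2 / 2)"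
    by (intro sum_mono *)
  also have "\<dots> = (\<Sum>i\<in>{1..n}. \<Sum>j\<in>{1..n}. adj g i j * (x i)\<^sup>2 / 2)
      + (\<Sum>j\<in>{1..n}. \<Sum>i\<in>{1..n}. adj g j i * (x j)\<^sup>2 / 2)"
    unfolding sum.distrib by (subst (2) sum.swap) (simp add: adj_sym)
  also have "\<dots> = (\<Sum>i\<in>{1..n}. deg n g i * (x i)\<^sup>2)"
    by (simp add: deg_def sum_distrib_right sum_divide_distrib[symmetric])
  also have "\<dots> \<le> (\<Sum>i\<in>{1..n}. d * (x i)\<^sup>2)"
    by (intro sum_mono mult_right_mono d) auto
  finally show "(\<Sum>i\<in>{1..n}. \<Sum>j\<in>{1..n}. adj g i j * x i * x j) \<le> d * (\<Sum>i\<in>{1..n}. (x i)\<^sup>2)"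
    by (simp add: sum_distrib_left)
qed

lemma deg_le: "deg n g i \<le> n"
proof -
  have "deg n g i \<le> (\<Sum>j\<in>{1..n}. 1)"
    unfolding deg_def by (intro sum_mono) (simp add: adj_def)
  then show ?thesis by simp
qed

lemma largest_eigenvalue_le_n:
  assumes "n \<ge> 1"
  shows "largest_eigenvalue n g \<le> n"
  by (rule largest_eigenvalue_le_max_deg[OF assms deg_le])

lemma largest_eigenvalue_regular:
  assumes n: "n \<ge> 1" and "\<And>i. i \<in> {1..n} \<Longrightarrow> deg n g i = d"
  shows "largest_eigenvalue n g = d"
proof (rule antisym)
  show "largest_eigenvalue n g \<le> d"
    using assms by (intro largest_eigenvalue_le_max_deg) auto
  have "mean_deg n g = d"
    using assms by (simp add: mean_deg_def)
  then show "d \<le> largest_eigenvalue n g"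
    using mean_deg_le_largest_eigenvalue[OF n, of g] by simp
qed

text \<open>At the all-ones vector the form of the centred matrix equals n times the deviation of
  the mean degree, while the norm bound allows at most h n.\<close>

lemma mean_deg_close:
  fixes q :: real
  assumes n: "n \<ge> 1" and g: "g \<in> graphs n" and h: "h \<ge> 0"
    and op: "\<And>x. (\<Sum>i\<in>{1..n}. (mat_op {1..n} (centred q g) x i)\<^sup>2) \<le> h\<^sup>2 * (\<Sum>i\<in>{1..n}. (x i)\<^sup>2)"
  shows "\<bar>mean_deg n g - q * (n - 1)\<bar> \<le> h"
proof -
  have "(\<Sum>i\<in>{1..n}. \<Sum>j\<in>{1..n}. centred q g i j * 1 * 1) = (\<Sum>i\<in>{1..n}. deg n g i - q * (n - 1))"
    using mat_op_centred_one[OF g] by (intro sum.cong) (auto simp: mat_op_def)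
  also have "\<dots> = n * (mean_deg n g - q * (n - 1))"
    using n by (simp add: sum_subtractf sum_deg algebra_simps)
  finally have "\<bar>n * (mean_deg n g - q * (n - 1))\<bar> \<le> h * n"
    using quadratic_form_abs_le[OF h op, of "\<lambda>_. 1"] by simp
  then have "n * \<bar>mean_deg n g - q * (n - 1)\<bar> \<le> n * h"
    by (simp add: abs_mult mult.commute)
  then show ?thesis
    using n by simp
qed

text \<open>The norm bound at the all-ones vector controls the second moment of the degrees about D,
  and a second moment is smallest about the mean.\<close>

lemma deg_var_le:
  assumes n: "n \<ge> 1" and g: "g \<in> graphs n"
    and op: "\<And>x. (\<Sum>i\<in>{1..n}. (mat_op {1..n} (centred q g) x i)\<^sup>2) \<le> h\<^sup>2 * (\<Sum>i\<in>{1..n}. (x i)\<^sup>2)"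
  shows "deg_var n g \<le> h\<^sup>2"
proof -
  define D where "D = q * (n - 1)"
  define m where "m = mean_deg n g"
  have "(\<Sum>i\<in>{1..n}. (deg n g i - D)\<^sup>2) \<le> h\<^sup>2 * n"
    using op[of "\<lambda>_. 1"] mat_op_centred_one[OF g] by (simp add: D_def)
  moreover have "(\<Sum>i\<in>{1..n}. (deg n g i - D)\<^sup>2)
      = (\<Sum>i\<in>{1..n}. (deg n g i - m)\<^sup>2 + 2 * (m - D) * (deg n g i - m) + (m - D)\<^sup>2)"
    by (intro sum.cong refl) (simp add: power2_eq_square algebra_simps)
  moreover have "\<dots> = (\<Sum>i\<in>{1..n}. (deg n g i - m)\<^sup>2) + n * (m - D)\<^sup>2"
    using n by (simp add: sum.distrib sum_distrib_left[symmetric] sum_subtractf sum_deg m_def)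
  ultimately have "(\<Sum>i\<in>{1..n}. (deg n g i - m)\<^sup>2) \<le> h\<^sup>2 * n"
    by (smt (verit) mult_nonneg_nonneg of_nat_0_le_iff zero_le_power2)
  then show ?thesis
    using n by (simp add: deg_var_def m_def field_simps)
qed

text \<open>Splitting a vector into its mean and a part orthogonal to the constants reduces the
  quadratic form to a two-dimensional one with diagonal \<open>mean_deg n g\<close>, \<open>h\<close> and the square root
  of \<open>deg_var n g\<close> off the diagonal.\<close>

lemma largest_eigenvalue_upper:
  assumes n: "n \<ge> 1" and g: "g \<in> graphs n" and h: "h \<ge> 0" and q: "q \<ge> 0"
    and op: "\<And>x. (\<Sum>i\<in>{1..n}. (mat_op {1..n} (centred q g) x i)\<^sup>2) \<le> h\<^sup>2 * (\<Sum>i\<in>{1..n}. (x i)\<^sup>2)"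
    and m: "h < mean_deg n g"
  shows "largest_eigenvalue n g \<le> mean_deg n g + deg_var n g / (mean_deg n g - h)"
proof (rule largest_eigenvalue_le[OF n])
  fix x :: "nat \<Rightarrow> real"
  define m where "m = mean_deg n g"
  \<comment> \<open>Weight in the inequality 2 x y <= x^2 / \<gamma> + \<gamma> y^2 for the cross
    term. With this choice \<open>\<gamma> * W + h * W = m * W\<close>, so the part orthogonal to
    the constants costs no more than m.\<close>
  define \<gamma> where "\<gamma> = m - h"
  have \<gamma>: "\<gamma> > 0" using m by (simp add: \<gamma>_def m_def)
  define a where "a = (\<Sum>i\<in>{1..n}. x i) / n"
  define w where "w i = x i - a" for i
  define W where "W = (\<Sum>i\<in>{1..n}. (w i)\<^sup>2)"
  define s where "s = deg_var n g"
  have s: "(\<Sum>i\<in>{1..n}. (deg n g i - m)\<^sup>2) = n * s" "s \<ge> 0"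
    using n deg_var_nonneg by (simp_all add: s_def deg_var_def m_def)
  have W: "W \<ge> 0" by (simp add: W_def sum_nonneg)
  have w0: "(\<Sum>i\<in>{1..n}. w i) = 0"
    using n by (simp add: w_def sum_subtractf a_def)
  have xw: "x i = a + w i" for i by (simp add: w_def)
  have norm: "(\<Sum>i\<in>{1..n}. (x i)\<^sup>2) = n * a\<^sup>2 + W"
  proof -
    have "(\<Sum>i\<in>{1..n}. (x i)\<^sup>2) = (\<Sum>i\<in>{1..n}. a\<^sup>2 + 2 * a * w i + (w i)\<^sup>2)"
      by (intro sum.cong refl) (simp add: xw power2_eq_square algebra_simps)
    then show ?thesis
      by (simp add: sum.distrib sum_distrib_left[symmetric] w0 W_def)
  qed
  have "(\<Sum>i\<in>{1..n}. \<Sum>j\<in>{1..n}. adj g i j * w i * w j) \<le> h * W"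
    using quadratic_form_centred[OF g, of w q] quadratic_form_abs_le[OF h op, of w] q W
    by (simp add: w0 W_def[symmetric]) (smt (verit) mult_nonneg_nonneg)
  moreover have "2 * a * (\<Sum>i\<in>{1..n}. deg n g i * w i) \<le> n * a\<^sup>2 * (s / \<gamma>) + \<gamma> * W"
  proof -
    have am: "2 * a * ((deg n g i - m) * w i) \<le> a\<^sup>2 * (deg n g i - m)\<^sup>2 / \<gamma> + \<gamma> * (w i)\<^sup>2" for i
    proof -
      have "0 \<le> (a * (deg n g i - m) - \<gamma> * w i)\<^sup>2 / \<gamma>"
        using \<gamma> by simp
      also have "\<dots> = a\<^sup>2 * (deg n g i - m)\<^sup>2 / \<gamma> + \<gamma> * (w i)\<^sup>2 - 2 * a * ((deg n g i - m) * w i)"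
        using \<gamma> by (simp add: field_simps power2_eq_square)
      finally show ?thesis by simp
    qed
    have "(\<Sum>i\<in>{1..n}. deg n g i * w i) = (\<Sum>i\<in>{1..n}. (deg n g i - m) * w i)"
      by (simp add: left_diff_distrib sum_subtractf sum_distrib_left[symmetric] w0)
    then have "2 * a * (\<Sum>i\<in>{1..n}. deg n g i * w i) = (\<Sum>i\<in>{1..n}. 2 * a * ((deg n g i - m) * w i))"
      by (simp add: sum_distrib_left)
    also have "\<dots> \<le> (\<Sum>i\<in>{1..n}. a\<^sup>2 * (deg n g i - m)\<^sup>2 / \<gamma> + \<gamma> * (w i)\<^sup>2)"
      by (intro sum_mono am)
    also have "\<dots> = a\<^sup>2 * (n * s) / \<gamma> + \<gamma> * W"
      by (simp add: sum.distrib sum_distrib_left[symmetric] sum_divide_distrib[symmetric] s W_def)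
    finally show ?thesis by (simp add: mult_ac)
  qed
  moreover have "(\<Sum>i\<in>{1..n}. \<Sum>j\<in>{1..n}. adj g i j * x i * x j)
      = a\<^sup>2 * (n * m) + 2 * a * (\<Sum>i\<in>{1..n}. deg n g i * w i)
        + (\<Sum>i\<in>{1..n}. \<Sum>j\<in>{1..n}. adj g i j * w i * w j)"
    unfolding xw quadratic_form_shift using n by (simp add: sum_deg m_def)
  ultimately have "(\<Sum>i\<in>{1..n}. \<Sum>j\<in>{1..n}. adj g i j * x i * x j)
      \<le> a\<^sup>2 * (n * m) + (n * a\<^sup>2 * (s / \<gamma>) + \<gamma> * W) + h * W"
    by linarith
  also have "\<dots> \<le> (m + s / \<gamma>) * (n * a\<^sup>2 + W)"
  proof -
    have "(m + s / \<gamma>) * (n * a\<^sup>2 + W)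
        - (a\<^sup>2 * (n * m) + (n * a\<^sup>2 * (s / \<gamma>) + \<gamma> * W) + h * W) = s / \<gamma> * W"
    proof -
      have "W * m = W * \<gamma> + W * h" by (simp add: \<gamma>_def algebra_simps)
      then show ?thesis by (simp add: algebra_simps)
    qed
    moreover have "s / \<gamma> * W \<ge> 0" using s \<gamma> W by simp
    ultimately show ?thesis by (metis diff_ge_0_iff_ge)
  qed
  finally show "(\<Sum>i\<in>{1..n}. \<Sum>j\<in>{1..n}. adj g i j * x i * x j)
      \<le> (mean_deg n g + deg_var n g / (mean_deg n g - h)) * (\<Sum>i\<in>{1..n}. (x i)\<^sup>2)"
    by (simp add: norm m_def \<gamma>_def s_def)
qed

text \<open>Rayleigh quotient of the test vector $1 + (k_i - \bar k) / D$.\<close>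

lemma largest_eigenvalue_lower:
  fixes q :: real
  assumes n: "n \<ge> 1" and g: "g \<in> graphs n" and h: "h \<ge> 0" and q: "q \<ge> 0"
    and op: "\<And>x. (\<Sum>i\<in>{1..n}. (mat_op {1..n} (centred q g) x i)\<^sup>2) \<le> h\<^sup>2 * (\<Sum>i\<in>{1..n}. (x i)\<^sup>2)"
    and D: "D = q * (n - 1)" "D > 0"
  shows "mean_deg n g + deg_var n g / D * (1 - 2 * h / D - q / D) / (1 + deg_var n g / D\<^sup>2)
    \<le> largest_eigenvalue n g"
proof -
  define m where "m = mean_deg n g"
  define s where "s = deg_var n g"
  define w where "w i = (deg n g i - m) / D" for i
  define W where "W = (\<Sum>i\<in>{1..n}. (w i)\<^sup>2)"
  define R where "R = (\<Sum>i\<in>{1..n}. \<Sum>j\<in>{1..n}. adj g i j * w i * w j)"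
  have s: "(\<Sum>i\<in>{1..n}. (deg n g i - m)\<^sup>2) = n * s" "s \<ge> 0"
    using n deg_var_nonneg by (simp_all add: s_def deg_var_def m_def)
  have W: "W = n * s / D\<^sup>2"
    by (simp add: W_def w_def power_divide sum_divide_distrib[symmetric] s)
  have w0: "(\<Sum>i\<in>{1..n}. w i) = 0"
    using n by (simp add: w_def sum_subtractf sum_divide_distrib[symmetric] sum_deg m_def)
  have norm: "(\<Sum>i\<in>{1..n}. (1 + w i)\<^sup>2) = n * (1 + s / D\<^sup>2)"
  proof -
    have "(\<Sum>i\<in>{1..n}. (1 + w i)\<^sup>2) = (\<Sum>i\<in>{1..n}. 1 + 2 * w i + (w i)\<^sup>2)"
      by (intro sum.cong refl) (simp add: power2_eq_square algebra_simps)
    then show ?thesis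
      by (simp add: sum.distrib sum_distrib_left[symmetric] w0 W_def[symmetric] W distrib_left)
  qed
  have dw: "(\<Sum>i\<in>{1..n}. deg n g i * w i) = n * s / D"
  proof -
    have "(\<Sum>i\<in>{1..n}. deg n g i * w i) = (\<Sum>i\<in>{1..n}. (deg n g i - m) * w i)"
      by (simp add: left_diff_distrib sum_subtractf sum_distrib_left[symmetric] w0)
    also have "\<dots> = (\<Sum>i\<in>{1..n}. (deg n g i - m)\<^sup>2 / D)"
      by (simp add: w_def power2_eq_square)
    finally show ?thesis by (simp add: sum_divide_distrib[symmetric] s)
  qed
  have R: "R \<ge> - (h + q) * W"
    using quadratic_form_centred[OF g, of w q] quadratic_form_abs_le[OF h op, of w]
    by (simp add: w0 W_def[symmetric] R_def algebra_simps)
  have "n * m + 2 * (n * s / D) + R \<le> largest_eigenvalue n g * (n * (1 + s / D\<^sup>2))"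
    using quadratic_form_le_largest_eigenvalue[OF n, of g "\<lambda>i. 1 + w i"] n
    unfolding norm quadratic_form_shift dw by (simp add: sum_deg m_def R_def)
  moreover have "n * (m + 2 * (s / D) - (h + q) * (s / D\<^sup>2)) = n * m + 2 * (n * s / D) + - (h + q) * W"
    by (simp add: W algebra_simps diff_divide_distrib add_divide_distrib)
  ultimately have "n * (m + 2 * (s / D) - (h + q) * (s / D\<^sup>2))
      \<le> n * (largest_eigenvalue n g * (1 + s / D\<^sup>2))"
    using R by (simp add: mult.left_commute)
  then have *: "m + 2 * (s / D) - (h + q) * (s / D\<^sup>2) \<le> largest_eigenvalue n g * (1 + s / D\<^sup>2)"
    using n by simp
  \<comment> \<open>Dividing by the squared norm of the test vector costs
    \<open>m * (s / D\<^sup>2)\<close>, close to \<open>s / D\<close>, which is half of the cross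
    term \<open>2 * (s / D)\<close>. Replacing m by D + h makes this cost explicit.\<close>
  have "m \<le> D + h"
    using mean_deg_close[OF n g h op] by (simp add: m_def D)
  then have "m * (s / D\<^sup>2) \<le> (D + h) * (s / D\<^sup>2)"
    using s by (intro mult_right_mono) auto
  moreover have "(D + h) * (s / D\<^sup>2) = s / D + h * (s / D\<^sup>2)"
    using D(2) by (simp add: power2_eq_square distrib_right add_divide_distrib)
  moreover have "m * (1 + s / D\<^sup>2) = m + m * (s / D\<^sup>2)"
    by (simp add: distrib_left)
  moreover have "(s / D) * (1 - 2 * h / D - q / D) = s / D - 2 * (h * (s / D\<^sup>2)) - q * (s / D\<^sup>2)"
    by (simp add: right_diff_distrib power2_eq_square mult_ac)
  moreover have "(h + q) * (s / D\<^sup>2) = h * (s / D\<^sup>2) + q * (s / D\<^sup>2)"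
    by (rule distrib_right)
  ultimately have "m * (1 + s / D\<^sup>2) + (s / D) * (1 - 2 * h / D - q / D)
      \<le> m + 2 * (s / D) - (h + q) * (s / D\<^sup>2)"
    by argo
  with * have "m * (1 + s / D\<^sup>2) + (s / D) * (1 - 2 * h / D - q / D)
      \<le> largest_eigenvalue n g * (1 + s / D\<^sup>2)" by linarith
  moreover have pos: "1 + s / D\<^sup>2 > 0"
    using s by (simp add: add_pos_nonneg)
  ultimately have "(m * (1 + s / D\<^sup>2) + (s / D) * (1 - 2 * h / D - q / D)) / (1 + s / D\<^sup>2)
      \<le> largest_eigenvalue n g"
    by (simp add: pos_divide_le_eq)
  then show ?thesis
    using pos by (simp add: add_divide_distrib m_def s_def)
qed

section \<open>Erdos--Renyi and Gibbs distributions\<close>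

lemma finite_pairs: "finite (nsets {1..n :: nat} 2)"
  by (simp add: finite_imp_finite_nsets)

lemma card_pairs: "card (nsets {1..n :: nat} 2) = n choose 2"
proof -
  have "nsets {1..n} 2 = {B. B \<subseteq> {1..n} \<and> card B = 2}"
    by (auto simp: nsets_def intro: finite_subset)
  then show ?thesis by (simp add: n_subsets)
qed

lemma set_pmf_erdos_renyi: "set_pmf (erdos_renyi n q) \<subseteq> graphs n"
  by (auto simp: erdos_renyi_def graphs_def)

lemma pmf_erdos_renyi:
  assumes q: "0 \<le> q" "q \<le> 1"
  shows "pmf (erdos_renyi n q) g =
    (if g \<in> graphs n then (\<Prod>e\<in>nsets {1..n} 2. if e \<in> g then q else 1 - q) else 0)"
proof (cases "g \<in> graphs n")
  case False
  then have "pmf (erdos_renyi n q) g = 0"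
    using set_pmf_erdos_renyi[of n q] by (metis set_pmf_iff subsetD)
  then show ?thesis using False by simp
next
  case True
  let ?E = "nsets {1..n} 2"
  let ?P = "Pi_pmf ?E False (\<lambda>_. bernoulli_pmf q)"
  have "pmf (erdos_renyi n q) g = measure ?P ((\<lambda>X. {e \<in> ?E. X e}) -` {g})"
    by (simp add: erdos_renyi_def pmf_map)
  \<comment> \<open>Off the pairs \<open>Pi_pmf\<close> forces the default False, so only one
    function in the preimage of g can carry mass.\<close>
  also have "\<dots> = measure ?P {\<lambda>e. e \<in> g}"
  proof (rule measure_prob_cong_0)
    fix X assume X: "X \<in> (\<lambda>X. {e \<in> ?E. X e}) -` {g} - {\<lambda>e. e \<in> g}"
    then obtain e where "X e \<noteq> (e \<in> g)" by auto
    with X have "e \<notin> ?E \<and> X e" by auto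
    then show "pmf ?P X = 0"
      by (intro pmf_Pi_outside finite_pairs) auto
  next
    fix X assume "X \<in> {\<lambda>e. e \<in> g} - (\<lambda>X. {e \<in> ?E. X e}) -` {g}"
    then show "pmf ?P X = 0"
      using True by (auto simp: graphs_def)
  qed
  also have "\<dots> = (\<Prod>e\<in>?E. pmf (bernoulli_pmf q) (e \<in> g))"
    using True by (subst measure_pmf_single, subst pmf_Pi') (auto simp: graphs_def finite_pairs)
  also have "\<dots> = (\<Prod>e\<in>?E. if e \<in> g then q else 1 - q)"
    using q by (intro prod.cong) auto
  finally show ?thesis using True by simp
qed

lemma pmf_erdos_renyi_card:
  assumes q: "0 \<le> q" "q \<le> 1" and g: "g \<in> graphs n"
  shows "pmf (erdos_renyi n q) g = q ^ card g * (1 - q) ^ ((n choose 2) - card g)"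
proof -
  have sub: "g \<subseteq> nsets {1..n} 2" using g by (simp add: graphs_def)
  have "(\<Prod>e\<in>nsets {1..n} 2. if e \<in> g then q else 1 - q)
      = (\<Prod>e\<in>nsets {1..n} 2 \<inter> g. q) * (\<Prod>e\<in>nsets {1..n} 2 - g. 1 - q)"
    using finite_pairs by (subst prod.If_cases) (auto simp: Diff_eq)
  also have "nsets {1..n} 2 \<inter> g = g" using sub by blast
  finally show ?thesis
    using sub g finite_pairs
    by (simp add: pmf_erdos_renyi q card_Diff_subset finite_subset card_pairs)
qed

lemma expectation_graph_pmf:
  fixes f :: "graph \<Rightarrow> real"
  assumes "set_pmf M \<subseteq> graphs n"
  shows "measure_pmf.expectation M f = (\<Sum>g\<in>graphs n. f g * pmf M g)"
  using assms by (intro integral_measure_pmf_real finite_graphs) auto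

lemma integrable_graph_pmf:
  fixes f :: "graph \<Rightarrow> real"
  assumes "set_pmf M \<subseteq> graphs n"
  shows "integrable (measure_pmf M) f"
  by (rule integrable_measure_pmf_finite) (rule finite_subset[OF assms finite_graphs])

text \<open>Independence of the edges: the sum over all graphs is the expansion of a product of
  binomials over the pairs, read backwards. Edge probabilities and walk expectations are both
  instances.\<close>

lemma expectation_erdos_renyi_prod:
  fixes u v :: "nat set \<Rightarrow> real"
  assumes q: "0 \<le> q" "q \<le> 1" and F: "F \<subseteq> nsets {1..n} 2"
  shows "measure_pmf.expectation (erdos_renyi n q) (\<lambda>g. \<Prod>e\<in>F. if e \<in> g then u e else v e)
    = (\<Prod>e\<in>F. q * u e + (1 - q) * v e)"
proof -
  let ?E = "nsets {1..n} 2"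
  \<comment> \<open>Pairs outside F receive the value 1 and contribute the factor q + (1 - q) =
    1.\<close>
  define u' v' where "u' e = (if e \<in> F then u e else 1)" and "v' e = (if e \<in> F then v e else 1)" for e
  have ext: "(\<Prod>e\<in>F. f e) = (\<Prod>e\<in>?E. if e \<in> F then f e else 1)" for f :: "nat set \<Rightarrow> real"
    using F finite_pairs by (subst prod.inter_restrict[symmetric]) (auto simp: Int_absorb1)
  have "(\<Prod>e\<in>F. if e \<in> g then u e else v e) * pmf (erdos_renyi n q) g
      = (\<Prod>e\<in>g. q * u' e) * (\<Prod>e\<in>?E - g. (1 - q) * v' e)" if g: "g \<in> graphs n" for g
  proof -
    have sub: "g \<subseteq> ?E" using g by (simp add: graphs_def)
    have "(\<Prod>e\<in>F. if e \<in> g then u e else v e) * pmf (erdos_renyi n q) g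
        = (\<Prod>e\<in>?E. (if e \<in> F then (if e \<in> g then u e else v e) else 1) * (if e \<in> g then q else 1 - q))"
      using g by (simp add: pmf_erdos_renyi[OF q] ext prod.distrib)
    also have "\<dots> = (\<Prod>e\<in>?E. if e \<in> g then q * u' e else (1 - q) * v' e)"
      by (intro prod.cong) (auto simp: u'_def v'_def)
    also have "\<dots> = (\<Prod>e\<in>?E \<inter> g. q * u' e) * (\<Prod>e\<in>?E - g. (1 - q) * v' e)"
      using finite_pairs by (subst prod.If_cases) (auto simp: Diff_eq)
    also have "?E \<inter> g = g" using sub by blast
    finally show ?thesis .
  qed
  then have "measure_pmf.expectation (erdos_renyi n q) (\<lambda>g. \<Prod>e\<in>F. if e \<in> g then u e else v e)
      = (\<Sum>g\<in>Pow ?E. (\<Prod>e\<in>g. q * u' e) * (\<Prod>e\<in>?E - g. (1 - q) * v' e))"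
    unfolding expectation_graph_pmf[OF set_pmf_erdos_renyi] by (simp add: graphs_def)
  also have "\<dots> = (\<Prod>e\<in>?E. q * u' e + (1 - q) * v' e)"
    by (rule prod_add[OF finite_pairs, symmetric])
  also have "\<dots> = (\<Prod>e\<in>F. q * u e + (1 - q) * v e)"
    unfolding ext by (intro prod.cong) (auto simp: u'_def v'_def)
  finally show ?thesis .
qed

lemma expectation_erdos_renyi_edges:
  assumes q: "0 \<le> q" "q \<le> 1" and F: "F \<subseteq> nsets {1..n} 2"
  shows "measure_pmf.expectation (erdos_renyi n q) (\<lambda>g. if F \<subseteq> g then 1 else 0) = q ^ card F"
proof -
  have fin: "finite F" using F finite_pairs finite_subset by blast
  have "(if F \<subseteq> g then 1 else 0) = (\<Prod>e\<in>F. if e \<in> g then 1 else (0 :: real))" for g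
  proof (cases "F \<subseteq> g")
    case True
    then have "(\<Prod>e\<in>F. if e \<in> g then 1 else (0 :: real)) = (\<Prod>e\<in>F. 1)"
      by (intro prod.cong) auto
    then show ?thesis using True by simp
  next
    case False
    then show ?thesis using fin by (auto intro!: prod_zero[symmetric])
  qed
  then show ?thesis
    using expectation_erdos_renyi_prod[OF q F, of "\<lambda>_. 1" "\<lambda>_. 0"] by simp
qed

text \<open>If $\theta$ and $\theta'$ give the same expected constraint values, then
  $\sum_g (P(g) - P'(g)) (\ln P(g) - \ln P'(g))$ vanishes although no summand is negative.\<close>

lemma gibbs_unique:
  assumes eq: "\<And>i. i \<in> {1..m} \<Longrightarrow>
    measure_pmf.expectation (gibbs n m C \<theta>) (\<lambda>g. C g i)
      = measure_pmf.expectation (gibbs n m C \<theta>') (\<lambda>g. C g i)"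
  shows "gibbs n m C \<theta> = gibbs n m C \<theta>'"
proof -
  define Z where "Z \<theta> = (\<Sum>h\<in>graphs n. gibbs_weight m C \<theta> h)" for \<theta>
  define P where "P \<theta> = pmf (gibbs n m C \<theta>)" for \<theta>
  have "graphs n \<noteq> {}" by (auto simp: graphs_def)
  then have Z: "Z \<theta> > 0" for \<theta>
    unfolding Z_def using finite_graphs by (intro sum_pos) (auto simp: gibbs_weight_def)
  have P: "P \<theta> g = gibbs_weight m C \<theta> g / Z \<theta>" if "g \<in> graphs n" for \<theta> g
    using that by (simp add: P_def pmf_gibbs Z_def)
  have Ppos: "P \<theta> g > 0" if "g \<in> graphs n" for \<theta> g
    using Z[of \<theta>] P[OF that] by (simp add: gibbs_weight_def)
  have lnP: "ln (P \<theta> g) = - (\<Sum>i\<in>{1..m}. \<theta> i * C g i) - ln (Z \<theta>)" if "g \<in> graphs n" for \<theta> g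
    using Z[of \<theta>] by (simp add: P[OF that] gibbs_weight_def ln_div)
  have supp: "set_pmf (gibbs n m C \<theta>) \<subseteq> graphs n" for \<theta>
    by (auto simp: set_pmf_iff pmf_gibbs split: if_splits)
  have one: "(\<Sum>g\<in>graphs n. P \<theta> g) = 1" for \<theta>
    unfolding P_def by (rule sum_pmf_eq_1[OF finite_graphs supp])
  have E: "(\<Sum>g\<in>graphs n. (P \<theta> g - P \<theta>' g) * C g i) = 0" if "i \<in> {1..m}" for i
    using eq[OF that] unfolding expectation_graph_pmf[OF supp]
    by (simp add: P_def algebra_simps sum_subtractf)
  have "(\<Sum>g\<in>graphs n. (P \<theta> g - P \<theta>' g) * (ln (P \<theta> g) - ln (P \<theta>' g)))
      = (\<Sum>g\<in>graphs n. (\<Sum>i\<in>{1..m}. (\<theta>' i - \<theta> i) * ((P \<theta> g - P \<theta>' g) * C g i))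
          + (ln (Z \<theta>') - ln (Z \<theta>)) * (P \<theta> g - P \<theta>' g))"
  proof (rule sum.cong)
    fix g assume g: "g \<in> graphs n"
    have "ln (P \<theta> g) - ln (P \<theta>' g)
        = (\<Sum>i\<in>{1..m}. (\<theta>' i - \<theta> i) * C g i) + (ln (Z \<theta>') - ln (Z \<theta>))"
      by (simp add: lnP[OF g] left_diff_distrib sum_subtractf)
    then show "(P \<theta> g - P \<theta>' g) * (ln (P \<theta> g) - ln (P \<theta>' g))
      = (\<Sum>i\<in>{1..m}. (\<theta>' i - \<theta> i) * ((P \<theta> g - P \<theta>' g) * C g i))
          + (ln (Z \<theta>') - ln (Z \<theta>)) * (P \<theta> g - P \<theta>' g)"
      by (simp add: distrib_left sum_distrib_left mult_ac)
  qed simp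
  also have "\<dots> = (\<Sum>i\<in>{1..m}. (\<theta>' i - \<theta> i) * (\<Sum>g\<in>graphs n. (P \<theta> g - P \<theta>' g) * C g i))
      + (ln (Z \<theta>') - ln (Z \<theta>)) * (\<Sum>g\<in>graphs n. P \<theta> g - P \<theta>' g)"
    unfolding sum.distrib sum_distrib_left by (subst sum.swap) simp
  also have "\<dots> = 0"
    using E by (simp add: sum_subtractf one)
  finally have sum0: "(\<Sum>g\<in>graphs n. (P \<theta> g - P \<theta>' g) * (ln (P \<theta> g) - ln (P \<theta>' g))) = 0" .
  have nonneg: "(P \<theta> g - P \<theta>' g) * (ln (P \<theta> g) - ln (P \<theta>' g)) \<ge> 0" if "g \<in> graphs n" for g
    using Ppos[OF that, of \<theta>] Ppos[OF that, of \<theta>']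
    by (cases "P \<theta> g \<le> P \<theta>' g") (auto intro: mult_nonpos_nonpos mult_nonneg_nonneg)
  have "P \<theta> g = P \<theta>' g" for g
  proof (cases "g \<in> graphs n")
    case True
    have "(P \<theta> g - P \<theta>' g) * (ln (P \<theta> g) - ln (P \<theta>' g)) = 0"
      using sum0 True by (subst (asm) sum_nonneg_eq_0_iff) (auto intro: finite_graphs nonneg)
    then show ?thesis
      using Ppos[OF True, of \<theta>] Ppos[OF True, of \<theta>'] by auto
  next
    case False
    then show ?thesis by (simp add: P_def pmf_gibbs)
  qed
  then show ?thesis
    by (intro pmf_eqI) (simp add: P_def)
qed

text \<open>The parameter picked by \<open>SOME\<close> may differ from \<theta>, but it meets the
  same constraints and therefore defines the same law.\<close>

lemma canonical_eq:
  assumes "\<And>i. i \<in> {1..m} \<Longrightarrow> measure_pmf.expectation (gibbs n m C \<theta>) (\<lambda>g. C g i) = c i"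
  shows "canonical n m C c = gibbs n m C \<theta>"
proof -
  let ?ok = "\<lambda>\<theta>. \<forall>i\<in>{1..m}. measure_pmf.expectation (gibbs n m C \<theta>) (\<lambda>g. C g i) = c i"
  have "?ok (SOME \<theta>. ?ok \<theta>)"
    by (rule someI[of ?ok \<theta>]) (use assms in blast)
  then show ?thesis
    unfolding canonical_def using assms by (intro gibbs_unique) simp
qed

text \<open>Up to the constant (1 - q)^N, with N the number of pairs, the Erdos--Renyi mass of g is
  the odds q / (1 - q) raised to the number of edges. It is thus an exponential weight in the edge
  number, with the log odds against an edge as multiplier.\<close>

lemma gibbs_eq_erdos_renyi:
  assumes q: "0 < q" "q < 1"
    and lin: "\<And>g. g \<in> graphs n \<Longrightarrow> (\<Sum>i\<in>{1..m}. \<theta> i * C g i) = ln ((1 - q) / q) * card g"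
  shows "gibbs n m C \<theta> = erdos_renyi n q"
proof (rule pmf_eqI)
  let ?N = "n choose 2"
  have w: "gibbs_weight m C \<theta> g = pmf (erdos_renyi n q) g / (1 - q) ^ ?N" if g: "g \<in> graphs n" for g
  proof -
    have le: "card g \<le> ?N"
      using g card_mono[OF finite_pairs, of g n] by (simp add: graphs_def card_pairs)
    have "gibbs_weight m C \<theta> g = exp (real (card g) * ln (q / (1 - q)))"
      using q by (simp add: gibbs_weight_def lin[OF g] ln_div algebra_simps)
    also have "\<dots> = (q / (1 - q)) ^ card g"
      using q by (simp add: exp_of_nat_mult)
    also have "\<dots> = q ^ card g * (1 - q) ^ (?N - card g) / (1 - q) ^ ?N"
      using q le by (simp add: power_divide power_diff)
    finally show ?thesis
      using q g by (simp add: pmf_erdos_renyi_card)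
  qed
  have "(\<Sum>h\<in>graphs n. gibbs_weight m C \<theta> h) = (\<Sum>h\<in>graphs n. pmf (erdos_renyi n q) h) / (1 - q) ^ ?N"
    by (simp add: w sum_divide_distrib)
  also have "\<dots> = 1 / (1 - q) ^ ?N"
    by (simp add: sum_pmf_eq_1[OF finite_graphs set_pmf_erdos_renyi])
  finally have Z: "(\<Sum>h\<in>graphs n. gibbs_weight m C \<theta> h) = 1 / (1 - q) ^ ?N" .
  show "pmf (gibbs n m C \<theta>) g = pmf (erdos_renyi n q) g" for g
    using q by (cases "g \<in> graphs n") (simp_all add: pmf_gibbs Z, simp_all add: w pmf_erdos_renyi)
qed

section \<open>Counting walks\<close>

fun steps :: "'a list \<Rightarrow> 'a set list" where
  "steps (i # j # vs) = {i, j} # steps (j # vs)"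
| "steps vs = []"

text \<open>k counts vertices, so a walk with k steps lies in
  \<open>walks V (Suc k)\<close>.\<close>

definition walks :: "'a set \<Rightarrow> nat \<Rightarrow> 'a list set" where
  "walks V k = {vs. set vs \<subseteq> V \<and> length vs = k}"

fun walk_weight :: "('a \<Rightarrow> 'a \<Rightarrow> real) \<Rightarrow> 'a list \<Rightarrow> real" where
  "walk_weight a (i # j # vs) = a i j * walk_weight a (j # vs)"
| "walk_weight a vs = 1"

lemma length_steps: "length (steps vs) = length vs - 1"
  by (induction vs rule: steps.induct) auto

lemma walks_0: "walks V 0 = {[]}"
  by (auto simp: walks_def)

lemma sum_walks_Suc:
  "(\<Sum>vs\<in>walks V (Suc k). f vs) = (\<Sum>j\<in>V. \<Sum>vs\<in>walks V k. f (j # vs))"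
proof -
  have "walks V (Suc k) = (\<lambda>(j, vs). j # vs) ` (V \<times> walks V k)"
    by (auto simp: walks_def length_Suc_conv image_iff)
  moreover have "inj_on (\<lambda>(j, vs). j # vs) (V \<times> walks V k)"
    by (auto simp: inj_on_def)
  ultimately show ?thesis
    by (simp add: sum.reindex sum.cartesian_product case_prod_unfold)
qed

lemma mat_op_pow_walks:
  "(mat_op V a ^^ k) x i = (\<Sum>vs\<in>walks V k. walk_weight a (i # vs) * x (last (i # vs)))"
proof (induction k arbitrary: i)
  case (Suc k)
  have "(mat_op V a ^^ Suc k) x i = (\<Sum>j\<in>V. a i j * (mat_op V a ^^ k) x j)"
    by (simp add: mat_op_def)
  then show ?case
    by (simp add: Suc.IH sum_walks_Suc sum_distrib_left mult.assoc)
qed (simp add: walks_0)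

lemma trace_pow_walks:
  "trace_pow V a k = (\<Sum>vs\<in>walks V (Suc k). if last vs = hd vs then walk_weight a vs else 0)"
  unfolding trace_pow_def mat_op_pow_walks sum_walks_Suc
  by (intro sum.cong) auto

lemma prod_list_map_count:
  fixes f :: "'a \<Rightarrow> 'b :: comm_monoid_mult"
  assumes "finite X" "set xs \<subseteq> X"
  shows "prod_list (map f xs) = (\<Prod>x\<in>X. f x ^ count_list xs x)"
  using assms(2)
proof (induction xs)
  case (Cons y xs)
  have "(\<Prod>x\<in>X. f x ^ count_list (y # xs) x)
      = (\<Prod>x\<in>X. (if x = y then f x else 1) * f x ^ count_list xs x)"
    by (intro prod.cong) (auto simp: power_add mult.commute)
  also have "\<dots> = f y * (\<Prod>x\<in>X. f x ^ count_list xs x)"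
    using Cons.prems assms(1) by (simp add: prod.distrib)
  finally show ?case using Cons by simp
qed simp

text \<open>A walk may stay at a vertex, and the step is then a singleton; the value 0 off the pairs
  matches the zero diagonal of the centred matrix.\<close>

definition edge_dev :: "real \<Rightarrow> graph \<Rightarrow> nat set \<Rightarrow> real" where
  "edge_dev q g e = (if card e = 2 then (if e \<in> g then 1 - q else - q) else 0)"

lemma walk_weight_centred:
  "walk_weight (centred q g) vs = prod_list (map (edge_dev q g) (steps vs))"
  by (induction vs rule: steps.induct)
    (auto simp: centred_def edge_dev_def adj_def card_insert_if)

lemma steps_subset: "set vs \<subseteq> V \<Longrightarrow> e \<in> set (steps vs) \<Longrightarrow> e \<subseteq> V \<and> finite e"
  by (induction vs rule: steps.induct) auto

text \<open>Powers of numbers in [0, 1] decrease in the exponent, so all these moments are dominated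
  by the variance q (1 - q).\<close>

lemma central_moment_bernoulli_abs_le:
  fixes q :: real
  assumes q: "0 \<le> q" "q \<le> 1" and k: "k \<ge> 2"
  shows "\<bar>q * (1 - q) ^ k + (1 - q) * (- q) ^ k\<bar> \<le> q"
proof -
  have "\<bar>q * (1 - q) ^ k + (1 - q) * (- q) ^ k\<bar> \<le> q * (1 - q) ^ k + (1 - q) * q ^ k"
    using q by (intro order_trans[OF abs_triangle_ineq]) (simp add: abs_mult power_abs)
  also have "\<dots> \<le> q * (1 - q)\<^sup>2 + (1 - q) * q\<^sup>2"
    using q k by (intro add_mono mult_left_mono power_decreasing) auto
  also have "\<dots> = q - q\<^sup>2"
    by (simp add: power2_eq_square algebra_simps)
  finally show ?thesis by (simp add: order_trans)
qed

text \<open>Grouping the steps by edge and using independence, the expectation is a product of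
  central Bernoulli moments, one for each distinct edge. The first moment is zero, so an edge
  traversed just once kills the product; every other edge contributes at most q.\<close>

lemma expectation_walk_weight_abs_le:
  assumes q: "0 \<le> q" "q \<le> 1" and vs: "set vs \<subseteq> {1..n}"
  shows "\<bar>measure_pmf.expectation (erdos_renyi n q) (\<lambda>g. walk_weight (centred q g) vs)\<bar>
    \<le> (if \<forall>e\<in>set (steps vs). count_list (steps vs) e \<ge> 2 then q ^ card (set (steps vs)) else 0)"
proof (cases "set (steps vs) \<subseteq> nsets {1..n} 2")
  case False
  then obtain e where e: "e \<in> set (steps vs)" "e \<notin> nsets {1..n} 2" by blast
  then have "card e \<noteq> 2"
    using steps_subset[OF vs e(1)] by (simp add: nsets_def)
  then have "walk_weight (centred q g) vs = 0" for g
    using e(1) by (simp add: walk_weight_centred prod_list_zero_iff edge_dev_def image_iff)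
      (metis (full_types))
  then show ?thesis using q by simp
next
  case True
  define F where "F = set (steps vs)"
  define c where "c = count_list (steps vs)"
  have "walk_weight (centred q g) vs = (\<Prod>e\<in>F. if e \<in> g then (1 - q) ^ c e else (- q) ^ c e)" for g
    unfolding walk_weight_centred F_def c_def
    using True by (subst prod_list_map_count[of "set (steps vs)"])
      (auto simp: edge_dev_def nsets_def intro!: prod.cong)
  then have E: "measure_pmf.expectation (erdos_renyi n q) (\<lambda>g. walk_weight (centred q g) vs)
      = (\<Prod>e\<in>F. q * (1 - q) ^ c e + (1 - q) * (- q) ^ c e)"
    using expectation_erdos_renyi_prod[OF q, of F n "\<lambda>e. (1 - q) ^ c e" "\<lambda>e. (- q) ^ c e"] True
    by (simp add: F_def)
  show ?thesis
  proof (cases "\<forall>e\<in>F. c e \<ge> 2")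
    case True
    have "\<bar>\<Prod>e\<in>F. q * (1 - q) ^ c e + (1 - q) * (- q) ^ c e\<bar> \<le> (\<Prod>e\<in>F. q)"
      unfolding abs_prod using True central_moment_bernoulli_abs_le[OF q] by (intro prod_mono) auto
    then show ?thesis using True unfolding E by (simp add: F_def c_def)
  next
    case False
    then obtain e where e: "e \<in> F" "\<not> c e \<ge> 2" by blast
    moreover have "c e \<noteq> 0"
      using e(1) by (simp add: F_def c_def count_list_0_iff)
    ultimately have "c e = 1" by simp
    then have "(\<Prod>e\<in>F. q * (1 - q) ^ c e + (1 - q) * (- q) ^ c e) = 0"
      using e(1) by (intro prod_zero) (auto simp: F_def intro!: bexI[of _ e])
    then show ?thesis using e unfolding E by (auto simp: F_def c_def)
  qed
qed

text \<open>Extend the walk at its front. A new vertex i either creates a new edge, at the price of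
  a factor s for each of the \<open>card V\<close> choices, or the edge {i, h} to the old front h
  has occurred before; as {i, h} determines i, there are at most M such i. Each step thus costs at
  most \<open>card V * s + M\<close>.\<close>

lemma sum_card_steps_le:
  fixes s :: real and M :: nat
  assumes V: "finite V" and s: "s \<ge> 0" and M: "k \<le> M"
  shows "(\<Sum>vs\<in>walks V (Suc k). s ^ card (set (steps vs))) \<le> card V * (card V * s + M) ^ k"
  using M
proof (induction k)
  case 0
  then show ?case by (simp add: sum_walks_Suc walks_0)
next
  case (Suc k)
  have step: "(\<Sum>i\<in>V. s ^ card (set (steps (i # vs)))) \<le> s ^ card (set (steps vs)) * (card V * s + M)"
    if vs: "vs \<in> walks V (Suc k)" for vs
  proof -
    obtain h ws where vs': "vs = h # ws"
      using vs by (cases vs) (auto simp: walks_def)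
    define S where "S = set (steps vs)"
    have "card S \<le> length (steps vs)" unfolding S_def by (rule card_length)
    also have "\<dots> \<le> M" using vs Suc.prems by (simp add: length_steps walks_def)
    finally have SM: "card S \<le> M" .
    have "inj_on (\<lambda>i. {i, h}) V"
      by (auto simp: inj_on_def doubleton_eq_iff)
    then have "card {i \<in> V. {i, h} \<in> S} = card ((\<lambda>i. {i, h}) ` {i \<in> V. {i, h} \<in> S})"
      by (metis (no_types, lifting) card_image inj_on_subset mem_Collect_eq subsetI)
    also have "\<dots> \<le> card S"
      unfolding S_def by (intro card_mono) auto
    finally have old: "card {i \<in> V. {i, h} \<in> S} \<le> M" using SM by simp
    have "(\<Sum>i\<in>V. s ^ card (set (steps (i # vs))))
        \<le> (\<Sum>i\<in>V. s ^ card S * s + (if {i, h} \<in> S then s ^ card S else 0))"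
    proof (rule sum_mono)
      fix i
      have "set (steps (i # vs)) = insert {i, h} S" by (simp add: vs' S_def)
      then show "s ^ card (set (steps (i # vs))) \<le> s ^ card S * s + (if {i, h} \<in> S then s ^ card S else 0)"
        using s by (auto simp: card_insert_if S_def insert_absorb)
    qed
    also have "\<dots> = s ^ card S * (card V * s + card {i \<in> V. {i, h} \<in> S})"
      using V by (simp add: sum.distrib sum.If_cases Int_def algebra_simps)
    also have "\<dots> \<le> s ^ card S * (card V * s + M)"
      using old s by (intro mult_left_mono) auto
    finally show ?thesis by (simp add: S_def)
  qed
  have "(\<Sum>vs\<in>walks V (Suc (Suc k)). s ^ card (set (steps vs)))
      = (\<Sum>vs\<in>walks V (Suc k). \<Sum>i\<in>V. s ^ card (set (steps (i # vs))))"
    by (subst sum_walks_Suc, subst sum.swap) simp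
  also have "\<dots> \<le> (\<Sum>vs\<in>walks V (Suc k). s ^ card (set (steps vs)) * (card V * s + M))"
    by (intro sum_mono step)
  also have "\<dots> = (\<Sum>vs\<in>walks V (Suc k). s ^ card (set (steps vs))) * (card V * s + M)"
    by (simp add: sum_distrib_right)
  also have "\<dots> \<le> card V * (card V * s + M) ^ k * (card V * s + M)"
    using Suc s by (intro mult_right_mono) auto
  finally show ?case by (simp add: mult_ac)
qed

text \<open>A walk of length $2K$ running at least twice through each of its edges has at most $K$
  edges, so $q^e \le t^{-K} (qt)^e$ for $t \le 1$; the choice $t = 2K/(nq)$ balances the two
  terms of the preceding bound.\<close>

lemma expectation_trace_pow_le:
  fixes q :: real
  assumes q: "0 < q" "q \<le> 1" and K: "K \<ge> 1" "2 * real K \<le> n * q"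
  shows "measure_pmf.expectation (erdos_renyi n q) (\<lambda>g. trace_pow {1..n} (centred q g) (2 * K))
    \<le> n * (8 * K * n * q) ^ K"
proof -
  define V where "V = {1..n}"
  define t where "t = 2 * K / (n * q)"
  have nq: "n * q > 0" using K by linarith
  have "n > 0" using K by (cases n) auto
  then have t: "0 < t" "t \<le> 1" "n * (q * t) = 2 * K"
    using K nq q by (auto simp: t_def field_simps)
  have finV: "finite V" by (simp add: V_def)
  have "measure_pmf.expectation (erdos_renyi n q) (\<lambda>g. trace_pow V (centred q g) (2 * K))
      = (\<Sum>vs\<in>walks V (Suc (2 * K)). measure_pmf.expectation (erdos_renyi n q)
          (\<lambda>g. if last vs = hd vs then walk_weight (centred q g) vs else 0))"
    unfolding trace_pow_walks
    by (rule Bochner_Integration.integral_sum) (rule integrable_graph_pmf[OF set_pmf_erdos_renyi])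
  also have "\<dots> \<le> (\<Sum>vs\<in>walks V (Suc (2 * K)). (q * t) ^ card (set (steps vs)) / t ^ K)"
  proof (rule sum_mono)
    fix vs assume vs: "vs \<in> walks V (Suc (2 * K))"
    let ?F = "set (steps vs)"
    have "measure_pmf.expectation (erdos_renyi n q)
          (\<lambda>g. if last vs = hd vs then walk_weight (centred q g) vs else 0)
        \<le> \<bar>measure_pmf.expectation (erdos_renyi n q) (\<lambda>g. walk_weight (centred q g) vs)\<bar>"
      by (cases "last vs = hd vs") auto
    also have "\<dots> \<le> (if \<forall>e\<in>?F. count_list (steps vs) e \<ge> 2 then q ^ card ?F else 0)"
      using vs q by (intro expectation_walk_weight_abs_le) (auto simp: walks_def V_def)
    also have "\<dots> \<le> (q * t) ^ card ?F / t ^ K"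
    proof (cases "\<forall>e\<in>?F. count_list (steps vs) e \<ge> 2")
      case True
      have "2 * card ?F = (\<Sum>e\<in>?F. 2)" by simp
      also have "\<dots> \<le> (\<Sum>e\<in>?F. count_list (steps vs) e)"
        using True by (intro sum_mono) auto
      also have "\<dots> = 2 * K"
        using vs by (simp add: sum_count_set length_steps walks_def)
      finally have "card ?F \<le> K" by simp
      then have "t ^ K \<le> t ^ card ?F"
        using t by (intro power_decreasing) auto
      then have "q ^ card ?F * t ^ K \<le> q ^ card ?F * t ^ card ?F"
        using q by (intro mult_left_mono) auto
      then show ?thesis
        using True t by (simp add: pos_le_divide_eq power_mult_distrib)
    next
      case False
      then show ?thesis using q t by auto
    qed
    finally show "measure_pmf.expectation (erdos_renyi n q)
          (\<lambda>g. if last vs = hd vs then walk_weight (centred q g) vs else 0)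
        \<le> (q * t) ^ card ?F / t ^ K" .
  qed
  also have "\<dots> \<le> (n * (n * (q * t) + real (2 * K)) ^ (2 * K)) / t ^ K"
    unfolding sum_divide_distrib[symmetric]
    using sum_card_steps_le[OF finV, of "q * t" "2 * K" "2 * K"] q t
    by (intro divide_right_mono) (auto simp: V_def)
  also have "\<dots> = n * ((4 * K)\<^sup>2 / t) ^ K"
    using t by (simp add: power_mult power_divide)
  also have "(4 * K)\<^sup>2 / t = 8 * K * n * q"
    using K by (simp add: t_def power2_eq_square field_simps)
  finally show ?thesis by (simp add: V_def)
qed

section \<open>Degree moments\<close>

lemma vdegree_eq_deg:
  assumes g: "g \<in> graphs n" and i: "i \<in> {1..n}"
  shows "real (vdegree g i) = deg n g i"
proof -
  have "bij_betw (\<lambda>j. {i, j}) {j \<in> {1..n}. {i, j} \<in> g} {e \<in> g. i \<in> e}"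
  proof (rule bij_betw_imageI)
    show "inj_on (\<lambda>j. {i, j}) {j \<in> {1..n}. {i, j} \<in> g}"
      by (auto simp: inj_on_def doubleton_eq_iff)
    show "(\<lambda>j. {i, j}) ` {j \<in> {1..n}. {i, j} \<in> g} = {e \<in> g. i \<in> e}"
    proof (intro equalityI subsetI)
      fix e assume e: "e \<in> {e \<in> g. i \<in> e}"
      then have "e \<in> nsets {1..n} 2" using g by (auto simp: graphs_def)
      then obtain x y where xy: "e = {x, y}" "x \<in> {1..n}" "y \<in> {1..n}"
        by (rule nsets2_E)
      with e show "e \<in> (\<lambda>j. {i, j}) ` {j \<in> {1..n}. {i, j} \<in> g}"
        by (auto simp: insert_commute)
    qed auto
  qed
  then have "vdegree g i = card {j \<in> {1..n}. {i, j} \<in> g}"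
    unfolding vdegree_def by (rule bij_betw_same_card[symmetric])
  then show ?thesis
    by (simp add: deg_def adj_def sum.If_cases Int_def)
qed

lemma finite_graph: "g \<in> graphs n \<Longrightarrow> finite g"
  using finite_subset[OF _ finite_pairs] by (auto simp: graphs_def)

lemma sum_vdegree:
  assumes g: "g \<in> graphs n"
  shows "(\<Sum>i\<in>{1..n}. real (vdegree g i)) = 2 * card g"
proof -
  have fin: "finite g" by (rule finite_graph[OF g])
  have "(\<Sum>i\<in>{1..n}. vdegree g i) = (\<Sum>i\<in>{1..n}. \<Sum>e\<in>g. if i \<in> e then 1 else 0)"
    using fin by (simp add: vdegree_def sum.If_cases Int_def)
  also have "\<dots> = (\<Sum>e\<in>g. \<Sum>i\<in>{1..n}. if i \<in> e then 1 else 0)"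
    by (rule sum.swap)
  also have "\<dots> = (\<Sum>e\<in>g. 2)"
  proof (rule sum.cong)
    fix e assume "e \<in> g"
    then have "e \<subseteq> {1..n}" "card e = 2" using g by (auto simp: graphs_def nsets_def)
    then show "(\<Sum>i\<in>{1..n}. if i \<in> e then 1 else 0) = (2 :: nat)"
      by (simp add: sum.If_cases Int_absorb1)
  qed simp
  finally have "(\<Sum>i\<in>{1..n}. vdegree g i) = 2 * card g" by simp
  then show ?thesis
    by (metis of_nat_mult of_nat_numeral of_nat_sum)
qed

lemma mean_deg_eq:
  assumes "g \<in> graphs n"
  shows "mean_deg n g = 2 * card g / n"
  unfolding mean_deg_def using sum_vdegree[OF assms] vdegree_eq_deg[OF assms] by simp

lemma card_star:
  assumes "i \<in> {1..n}"
  shows "card {e \<in> nsets {1..n} 2. i \<in> e} = n - 1"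
proof -
  let ?K = "nsets {1..n} 2"
  \<comment> \<open>The star at i is counted as the degree of i in the complete graph.\<close>
  have "?K \<in> graphs n" by (simp add: graphs_def)
  from vdegree_eq_deg[OF this assms]
  have "real (card {e \<in> ?K. i \<in> e}) = (\<Sum>j\<in>{1..n}. if j = i then 0 else 1)"
    using assms by (auto simp: vdegree_def deg_def adj_def intro!: sum.cong)
  also have "\<dots> = real (card ({1..n} - {i}))"
    by (subst sum.If_cases) (auto simp: Diff_eq Compl_eq)
  finally show ?thesis using assms by simp
qed

text \<open>The set A will be a star, giving a degree, or the set of all pairs, giving the number of
  edges. The law enters through two edge probabilities only, so that independent edges and uniform
  edge sets are treated together.\<close>

lemma
  fixes M :: "graph pmf" and q r :: real
  assumes supp: "set_pmf M \<subseteq> graphs n" and A: "A \<subseteq> nsets {1..n} 2"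
    and one: "\<And>e. e \<in> nsets {1..n} 2 \<Longrightarrow>
      measure_pmf.expectation M (\<lambda>g. if e \<in> g then 1 else 0) = q"
    and two: "\<And>e f. e \<in> nsets {1..n} 2 \<Longrightarrow> f \<in> nsets {1..n} 2 \<Longrightarrow> e \<noteq> f \<Longrightarrow>
      measure_pmf.expectation M (\<lambda>g. if e \<in> g \<and> f \<in> g then 1 else 0) = r"
  shows expectation_card_Int: "measure_pmf.expectation M (\<lambda>g. real (card (g \<inter> A))) = card A * q"
    and expectation_card_Int_sq: "measure_pmf.expectation M (\<lambda>g. (real (card (g \<inter> A)))\<^sup>2)
      = card A * (q + (real (card A) - 1) * r)"
proof -
  have fin: "finite A" using A finite_pairs finite_subset by blast
  have int: "integrable (measure_pmf M) f" for f :: "graph \<Rightarrow> real"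
    by (rule integrable_graph_pmf[OF supp])
  have card: "real (card (g \<inter> A)) = (\<Sum>e\<in>A. if e \<in> g then 1 else 0)" for g
    using fin by (simp add: sum.If_cases Int_commute)
  show "measure_pmf.expectation M (\<lambda>g. real (card (g \<inter> A))) = card A * q"
    unfolding card using A one by (subst Bochner_Integration.integral_sum[OF int]) (simp add: subset_iff)
  have "(\<lambda>g. (real (card (g \<inter> A)))\<^sup>2) = (\<lambda>g. \<Sum>e\<in>A. \<Sum>f\<in>A. if e \<in> g \<and> f \<in> g then 1 else 0)"
    unfolding card by (auto simp: power2_eq_square sum_product intro!: sum.cong)
  then have "measure_pmf.expectation M (\<lambda>g. (real (card (g \<inter> A)))\<^sup>2)
      = (\<Sum>e\<in>A. \<Sum>f\<in>A. measure_pmf.expectation M (\<lambda>g. if e \<in> g \<and> f \<in> g then 1 else 0))"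
    by (simp add: Bochner_Integration.integral_sum[OF int])
  also have "\<dots> = (\<Sum>e\<in>A. \<Sum>f\<in>A. r + (if f = e then q - r else 0))"
  proof (intro sum.cong refl)
    fix e f assume ef: "e \<in> A" "f \<in> A"
    show "measure_pmf.expectation M (\<lambda>g. if e \<in> g \<and> f \<in> g then 1 else 0) = r + (if f = e then q - r else 0)"
    proof (cases "f = e")
      case True
      then show ?thesis using one[of e] ef A by auto
    next
      case False
      then show ?thesis using two[of e f] ef A by auto
    qed
  qed
  also have "\<dots> = card A * (q + (real (card A) - 1) * r)"
    using fin by (simp add: sum.distrib algebra_simps)
  finally show "measure_pmf.expectation M (\<lambda>g. (real (card (g \<inter> A)))\<^sup>2)
      = card A * (q + (real (card A) - 1) * r)" .
qed

lemma real_choose_two: "real (n choose 2) = real n * (real n - 1) / 2"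
proof -
  have "even (n * (n - 1))" by (cases n) simp_all
  then have "real (n * (n - 1) div 2) = real (n * (n - 1)) / 2"
    using real_of_nat_div[of 2 "n * (n - 1)"] by simp
  then show ?thesis
    by (cases n) (simp_all add: choose_two algebra_simps)
qed

lemma deg_eq_card_Int:
  assumes g: "g \<in> graphs n" and i: "i \<in> {1..n}"
  shows "deg n g i = card (g \<inter> {e \<in> nsets {1..n} 2. i \<in> e})"
proof -
  have "{e \<in> g. i \<in> e} = g \<inter> {e \<in> nsets {1..n} 2. i \<in> e}"
    using g by (auto simp: graphs_def)
  then show ?thesis
    using vdegree_eq_deg[OF g i] by (simp add: vdegree_def)
qed

lemma expectation_graph_pmf_cong:
  fixes f h :: "graph \<Rightarrow> real"
  assumes "set_pmf M \<subseteq> graphs n" "\<And>g. g \<in> graphs n \<Longrightarrow> f g = h g"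
  shows "measure_pmf.expectation M f = measure_pmf.expectation M h"
  using assms by (simp add: expectation_graph_pmf)

text \<open>The variance is the mean of the squared degrees minus the squared mean degree, and the
  mean degree is 2 |g| / n; both parts are second moments of edge counts in a fixed set of
  pairs.\<close>

lemma
  fixes M :: "graph pmf" and q r :: real
  assumes n: "n \<ge> 1" and supp: "set_pmf M \<subseteq> graphs n"
    and one: "\<And>e. e \<in> nsets {1..n} 2 \<Longrightarrow>
      measure_pmf.expectation M (\<lambda>g. if e \<in> g then 1 else 0) = q"
    and two: "\<And>e f. e \<in> nsets {1..n} 2 \<Longrightarrow> f \<in> nsets {1..n} 2 \<Longrightarrow> e \<noteq> f \<Longrightarrow>
      measure_pmf.expectation M (\<lambda>g. if e \<in> g \<and> f \<in> g then 1 else 0) = r"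
  shows expectation_deg: "i \<in> {1..n} \<Longrightarrow> measure_pmf.expectation M (\<lambda>g. deg n g i) = q * (n - 1)"
    and expectation_mean_deg: "measure_pmf.expectation M (mean_deg n) = q * (n - 1)"
    and expectation_deg_var: "measure_pmf.expectation M (deg_var n)
      = (real n - 1) * (real n - 2) / n * (q - r)"
proof -
  let ?S = "\<lambda>i. {e \<in> nsets {1..n} 2. i \<in> e}"
  have int: "integrable (measure_pmf M) f" for f :: "graph \<Rightarrow> real"
    by (rule integrable_graph_pmf[OF supp])
  show deg: "measure_pmf.expectation M (\<lambda>g. deg n g i) = q * (n - 1)" if i: "i \<in> {1..n}" for i
  proof -
    have "measure_pmf.expectation M (\<lambda>g. deg n g i)
        = measure_pmf.expectation M (\<lambda>g. real (card (g \<inter> ?S i)))"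
      by (intro expectation_graph_pmf_cong[OF supp] deg_eq_card_Int i)
    then show ?thesis
      using expectation_card_Int[OF supp _ one two, of "?S i"] card_star[OF i] by auto
  qed
  show "measure_pmf.expectation M (mean_deg n) = q * (n - 1)"
    using n deg unfolding mean_deg_def[abs_def]
    by (simp add: Bochner_Integration.integral_sum[OF int])
  have var: "deg_var n g = (\<Sum>i\<in>{1..n}. (real (card (g \<inter> ?S i)))\<^sup>2) / n
      - 4 / (real n)\<^sup>2 * (real (card (g \<inter> nsets {1..n} 2)))\<^sup>2" if g: "g \<in> graphs n" for g
  proof -
    define m where "m = mean_deg n g"
    have "(\<Sum>i\<in>{1..n}. (deg n g i - m)\<^sup>2)
        = (\<Sum>i\<in>{1..n}. (deg n g i)\<^sup>2 - 2 * m * deg n g i + m\<^sup>2)"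
      by (intro sum.cong refl) (simp add: power2_eq_square algebra_simps)
    also have "\<dots> = (\<Sum>i\<in>{1..n}. (deg n g i)\<^sup>2) - 2 * m * (n * m) + n * m\<^sup>2"
      using n by (simp add: sum.distrib sum_subtractf sum_distrib_left[symmetric] sum_deg m_def)
    finally have "deg_var n g = (\<Sum>i\<in>{1..n}. (deg n g i)\<^sup>2) / n - m\<^sup>2"
      using n by (simp add: deg_var_def m_def[symmetric] field_simps power2_eq_square)
    moreover have "g \<inter> nsets {1..n} 2 = g" using g by (auto simp: graphs_def)
    moreover have "(\<Sum>i\<in>{1..n}. (deg n g i)\<^sup>2) = (\<Sum>i\<in>{1..n}. (real (card (g \<inter> ?S i)))\<^sup>2)"
      by (intro sum.cong refl) (simp add: deg_eq_card_Int[OF g])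
    ultimately show ?thesis
      by (simp add: m_def mean_deg_eq[OF g] power_divide power_mult_distrib)
  qed
  have "measure_pmf.expectation M (deg_var n)
      = measure_pmf.expectation M (\<lambda>g. (\<Sum>i\<in>{1..n}. (real (card (g \<inter> ?S i)))\<^sup>2) / n
          - 4 / (real n)\<^sup>2 * (real (card (g \<inter> nsets {1..n} 2)))\<^sup>2)"
    by (rule expectation_graph_pmf_cong[OF supp var])
  also have "\<dots> = (\<Sum>i\<in>{1..n}. measure_pmf.expectation M (\<lambda>g. (real (card (g \<inter> ?S i)))\<^sup>2)) / n
      - 4 / (real n)\<^sup>2 * measure_pmf.expectation M (\<lambda>g. (real (card (g \<inter> nsets {1..n} 2)))\<^sup>2)"
    by (simp add: Bochner_Integration.integral_diff[OF int int] Bochner_Integration.integral_sum[OF int])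
  also have "(\<Sum>i\<in>{1..n}. measure_pmf.expectation M (\<lambda>g. (real (card (g \<inter> ?S i)))\<^sup>2))
      = (\<Sum>i\<in>{1..n}. real (n - 1) * (q + (real (n - 1) - 1) * r))"
  proof (rule sum.cong)
    fix i assume i: "i \<in> {1..n}"
    show "measure_pmf.expectation M (\<lambda>g. (real (card (g \<inter> ?S i)))\<^sup>2)
        = real (n - 1) * (q + (real (n - 1) - 1) * r)"
      using expectation_card_Int_sq[OF supp _ one two, of "?S i"] card_star[OF i] by auto
  qed simp
  also have "measure_pmf.expectation M (\<lambda>g. (real (card (g \<inter> nsets {1..n} 2)))\<^sup>2)
      = real (n choose 2) * (q + (real (n choose 2) - 1) * r)"
    using expectation_card_Int_sq[OF supp order_refl one two] by (simp add: card_pairs)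
  also have "(\<Sum>i\<in>{1..n}. real (n - 1) * (q + (real (n - 1) - 1) * r)) / n
      - 4 / (real n)\<^sup>2 * (real (n choose 2) * (q + (real (n choose 2) - 1) * r))
      = (real n - 1) * (real n - 2) / n * (q - r)"
    using n by (simp add: real_choose_two of_nat_diff field_simps power2_eq_square)
  finally show "measure_pmf.expectation M (deg_var n) = (real n - 1) * (real n - 2) / n * (q - r)" .
qed

section \<open>The two ensembles\<close>

lemma edge_constraint_eq:
  assumes "g \<in> graphs n"
  shows "edge_constraint n g i = card g"
  unfolding edge_constraint_def sum_vdegree[OF assms] by simp

lemma erdos_renyi_one_edge:
  assumes q: "0 \<le> q" "q \<le> 1" and e: "e \<in> nsets {1..n} 2"
  shows "measure_pmf.expectation (erdos_renyi n q) (\<lambda>g. if e \<in> g then 1 else 0) = q"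
  using expectation_erdos_renyi_edges[OF q, of "{e}" n] e by simp

lemma erdos_renyi_two_edges:
  assumes q: "0 \<le> q" "q \<le> 1"
    and e: "e \<in> nsets {1..n} 2" and f: "f \<in> nsets {1..n} 2" and ne: "e \<noteq> f"
  shows "measure_pmf.expectation (erdos_renyi n q) (\<lambda>g. if e \<in> g \<and> f \<in> g then 1 else 0) = q\<^sup>2"
  using expectation_erdos_renyi_edges[OF q, of "{e, f}" n] e f ne
  by (simp add: card_insert_if numeral_2_eq_2)

lemma can_edges_eq_erdos_renyi:
  assumes n: "n \<ge> 2" and L: "L \<le> n choose 2"
  shows "can_edges n L = erdos_renyi n (real L / real (n choose 2))"
proof -
  define q where "q = real L / real (n choose 2)"
  have N: "real (n choose 2) > 0" using n by (simp add: zero_less_binomial)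
  have q: "0 \<le> q" "q \<le> 1" using L N by (auto simp: q_def)
  show ?thesis
  proof (cases "q = 0 \<or> q = 1")
    case True
    then show ?thesis unfolding can_edges_def by (auto simp: Let_def q_def)
  next
    case False
    then have q': "0 < q" "q < 1" using q by auto
    have G: "gibbs n 1 (edge_constraint n) (\<lambda>_. ln ((1 - q) / q)) = erdos_renyi n q"
      by (rule gibbs_eq_erdos_renyi[OF q']) (simp add: edge_constraint_eq)
    have "measure_pmf.expectation (erdos_renyi n q) (\<lambda>g. edge_constraint n g i) = real L" for i
    proof -
      have "measure_pmf.expectation (erdos_renyi n q) (\<lambda>g. edge_constraint n g i)
        = measure_pmf.expectation (erdos_renyi n q) (\<lambda>g. real (card (g \<inter> nsets {1..n} 2)))"
        by (intro expectation_graph_pmf_cong[OF set_pmf_erdos_renyi])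
          (auto simp: edge_constraint_eq graphs_def Int_absorb2)
      also have "\<dots> = real (n choose 2) * q"
        using expectation_card_Int[OF set_pmf_erdos_renyi order_refl erdos_renyi_one_edge[OF q]
          erdos_renyi_two_edges[OF q]] by (simp add: card_pairs)
      finally show ?thesis using N by (simp add: q_def)
    qed
    then have "canonical n 1 (edge_constraint n) (\<lambda>_. real L) = erdos_renyi n q"
      using canonical_eq[of 1 n "edge_constraint n" "\<lambda>_. ln ((1 - q) / q)" "\<lambda>_. real L"]
      by (simp add: G)
    then show ?thesis
      using False unfolding can_edges_def by (simp add: q_def Let_def)
  qed
qed

lemma can_regular_eq_erdos_renyi:
  assumes n: "n \<ge> 2" and d: "d \<le> n - 1"
  shows "can_regular n d = erdos_renyi n (real d / (real n - 1))"
proof -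
  define q where "q = real d / (real n - 1)"
  have q: "0 \<le> q" "q \<le> 1" using n d by (auto simp: q_def field_simps)
  show ?thesis
  proof (cases "q = 0 \<or> q = 1")
    case True
    then show ?thesis unfolding can_regular_def by (auto simp: Let_def q_def)
  next
    case False
    then have q': "0 < q" "q < 1" using q by auto
    \<comment> \<open>Every edge is counted in two degrees, so each vertex carries half of the log
      odds.\<close>
    define \<theta> where "\<theta> = ln ((1 - q) / q)"
    have G: "gibbs n n degree_constraint (\<lambda>_. \<theta> / 2) = erdos_renyi n q"
      by (rule gibbs_eq_erdos_renyi[OF q'])
        (simp add: degree_constraint_def sum_distrib_left[symmetric] sum_divide_distrib[symmetric]
          sum_vdegree \<theta>_def)
    have "measure_pmf.expectation (erdos_renyi n q) (\<lambda>g. degree_constraint g i) = real d"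
      if i: "i \<in> {1..n}" for i
    proof -
      have "measure_pmf.expectation (erdos_renyi n q) (\<lambda>g. degree_constraint g i)
        = measure_pmf.expectation (erdos_renyi n q) (\<lambda>g. deg n g i)"
        by (intro expectation_graph_pmf_cong[OF set_pmf_erdos_renyi])
          (simp add: degree_constraint_def vdegree_eq_deg[OF _ i])
      also have "\<dots> = q * real (n - 1)"
        using expectation_deg[OF _ set_pmf_erdos_renyi erdos_renyi_one_edge[OF q]
          erdos_renyi_two_edges[OF q] i] n by simp
      finally show ?thesis using n by (simp add: q_def of_nat_diff)
    qed
    then have "canonical n n degree_constraint (\<lambda>_. real d) = erdos_renyi n q"
      using canonical_eq[of n n degree_constraint "\<lambda>_. \<theta> / 2" "\<lambda>_. real d"]
      by (simp add: G)
    then show ?thesis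
      using False unfolding can_regular_def by (simp add: q_def Let_def)
  qed
qed

section \<open>Regular graphs: existence and eigenvalue\<close>

text \<open>The Cayley graph of the integers modulo n with connection set S. Only differences of a
  larger and a smaller vertex are used; closure of S under s -> n - s accounts for steps that wrap
  around.\<close>

lemma circulant_graph:
  assumes S: "S \<subseteq> {1..<n}" and sym: "\<And>s. s \<in> S \<Longrightarrow> n - s \<in> S"
  shows "\<exists>g\<in>graphs n. \<forall>i\<in>{1..n}. vdegree g i = card S"
proof -
  define g where "g = {e. \<exists>i j. e = {i, j} \<and> 1 \<le> i \<and> i < j \<and> j \<le> n \<and> j - i \<in> S}"
  have g: "g \<in> graphs n"
    by (auto simp: g_def graphs_def)
  have mem: "{i, j} \<in> g \<longleftrightarrow> 1 \<le> i \<and> j \<le> n \<and> j - i \<in> S" if "i < j" for i j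
    using that by (auto simp: g_def doubleton_eq_iff)
  have "vdegree g i = card S" if i: "i \<in> {1..n}" for i
  proof -
    define nb where "nb = {j \<in> {1..n}. {i, j} \<in> g}"
    have nb: "j \<in> nb \<longleftrightarrow> j \<in> {1..n} \<and> (i < j \<and> j - i \<in> S \<or> j < i \<and> i - j \<in> S)" for j
    proof (cases i j rule: linorder_cases)
      case less
      then show ?thesis using mem[of i j] i by (auto simp: nb_def)
    next
      case equal
      then show ?thesis using g by (auto simp: nb_def graphs_def nsets_def)
    next
      case greater
      then show ?thesis using mem[of j i] i by (auto simp: nb_def insert_commute)
    qed
    have S1: "1 \<le> s" "s < n" if "s \<in> S" for s using S that by auto
    have inv: "n - (n - s) = s" if "s \<in> S" for s using S1[OF that] by auto
    \<comment> \<open>The neighbour i + s modulo n, with representatives 1, ..., n.\<close>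
    have "bij_betw (\<lambda>s. if i + s \<le> n then i + s else i + s - n) S nb"
    proof (rule bij_betw_byWitness[where f' = "\<lambda>j. if i < j then j - i else j + n - i"])
      show "\<forall>s\<in>S. (if i < (if i + s \<le> n then i + s else i + s - n)
          then (if i + s \<le> n then i + s else i + s - n) - i
          else (if i + s \<le> n then i + s else i + s - n) + n - i) = s"
      proof
        fix s assume "s \<in> S"
        from S1[OF this] i show "(if i < (if i + s \<le> n then i + s else i + s - n)
          then (if i + s \<le> n then i + s else i + s - n) - i
          else (if i + s \<le> n then i + s else i + s - n) + n - i) = s" by auto
      qed
      show "\<forall>j\<in>nb. (if i + (if i < j then j - i else j + n - i) \<le> n
          then i + (if i < j then j - i else j + n - i)
          else i + (if i < j then j - i else j + n - i) - n) = j"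
        using i by (auto simp: nb)
      show "(\<lambda>s. if i + s \<le> n then i + s else i + s - n) ` S \<subseteq> nb"
      proof safe
        fix s assume s: "s \<in> S"
        show "(if i + s \<le> n then i + s else i + s - n) \<in> nb"
        proof (cases "i + s \<le> n")
          case True
          then show ?thesis using s S1[OF s] i by (simp add: nb)
        next
          case False
          then have "i - (i + s - n) = n - s" using S1[OF s] by simp
          moreover have "1 \<le> i + s - n" "i + s - n \<le> n" "i + s - n < i"
            using False S1[OF s] i by auto
          ultimately show ?thesis using False sym[OF s] by (simp add: nb)
        qed
      qed
      show "(\<lambda>j. if i < j then j - i else j + n - i) ` nb \<subseteq> S"
      proof safe
        fix j assume j: "j \<in> nb"
        show "(if i < j then j - i else j + n - i) \<in> S"
        proof (cases "i < j")
          case True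
          then show ?thesis using j by (simp add: nb)
        next
          case False
          with j have "i - j \<in> S" "j < i" by (auto simp: nb)
          moreover have "n - (i - j) = j + n - i" using i \<open>j < i\<close> by auto
          ultimately show ?thesis using False sym by metis
        qed
      qed
    qed
    then have "card S = card nb" by (rule bij_betw_same_card)
    also have "real (card nb) = deg n g i"
      by (simp add: deg_def adj_def nb_def sum.If_cases Int_def)
    finally show ?thesis
      using vdegree_eq_deg[OF g i] by simp
  qed
  with g show ?thesis by blast
qed

text \<open>For even d connect each vertex to the d / 2 nearest ones on either side of the cycle.
  For odd d the number n is even, and the antipodal shift n / 2, which is its own negative, adds the
  missing neighbour.\<close>

lemma regular_graph_exists:
  assumes n: "n \<ge> 1" and d: "d \<le> n - 1" and ev: "even (n * d)"
  shows "\<exists>g\<in>graphs n. \<forall>i\<in>{1..n}. vdegree g i = d"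
proof (cases "even d")
  case True
  then obtain k where k: "d = 2 * k" by blast
  define S where "S = {1..k} \<union> {n - k..<n}"
  have "S \<subseteq> {1..<n}" using d n by (auto simp: S_def k)
  moreover have "n - s \<in> S" if "s \<in> S" for s
    using that d n by (auto simp: S_def k)
  ultimately have "\<exists>g\<in>graphs n. \<forall>i\<in>{1..n}. vdegree g i = card S"
    by (rule circulant_graph)
  moreover have "card S = d"
    using d n unfolding S_def by (subst card_Un_disjoint) (auto simp: k)
  ultimately show ?thesis by simp
next
  case False
  then obtain k where k: "d = 2 * k + 1" by (rule oddE)
  from False ev obtain m where m: "n = 2 * m" by auto
  have km: "k < m" using d n by (simp add: k m)
  define S where "S = insert m ({1..k} \<union> {n - k..<n})"
  have "S \<subseteq> {1..<n}" using km by (auto simp: S_def m)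
  moreover have "n - s \<in> S" if "s \<in> S" for s
    using that km by (auto simp: S_def m)
  ultimately have "\<exists>g\<in>graphs n. \<forall>i\<in>{1..n}. vdegree g i = card S"
    by (rule circulant_graph)
  moreover have "card ({1..k} \<union> {n - k..<n}) = 2 * k"
    using km by (subst card_Un_disjoint) (auto simp: m)
  then have "card S = d"
    using km unfolding S_def by (subst card_insert_disjoint) (auto simp: m k)
  ultimately show ?thesis by simp
qed

lemma expectation_mic_regular:
  assumes n: "n \<ge> 1" and d: "d \<le> n - 1" and ev: "even (n * d)"
  shows "measure_pmf.expectation (mic_regular n d) (largest_eigenvalue n) = d"
proof -
  let ?G = "{g \<in> graphs n. \<forall>i\<in>{1..n}. degree_constraint g i = real d}"
  \<comment> \<open>\<open>pmf_of_set\<close> has a meaning only for a nonempty set; this is what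
    the circulant graphs are for.\<close>
  have ne: "?G \<noteq> {}"
    using regular_graph_exists[OF assms] by (auto simp: degree_constraint_def)
  have fin: "finite ?G" using finite_graphs by simp
  have eig: "largest_eigenvalue n g = d" if "g \<in> ?G" for g
    using that n vdegree_eq_deg[of g n]
    by (intro largest_eigenvalue_regular) (auto simp: degree_constraint_def)
  have "measure_pmf.expectation (mic_regular n d) (largest_eigenvalue n)
      = measure_pmf.expectation (mic_regular n d) (\<lambda>_. real d)"
    using eig ne fin
    by (intro integral_cong_AE) (auto simp: AE_measure_pmf_iff mic_regular_def microcanonical_def)
  then show ?thesis by simp
qed

section \<open>Mode of the binomial distribution\<close>

text \<open>The Poisson weights m^k / k! peak at k = m, here cross-multiplied to stay within the
  naturals: every factor of the factorial beyond m is at least m, and every factor up to m is at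
  most m.\<close>

lemma fact_mult_power_le: "fact m * m ^ k \<le> fact k * (m :: nat) ^ m"
proof (cases "m \<le> k")
  case True
  have "fact m * m ^ j \<le> (fact (m + j) :: nat)" for j
  proof (induction j)
    case (Suc j)
    have "fact m * m ^ Suc j = m * (fact m * m ^ j)" by simp
    also have "\<dots> \<le> Suc (m + j) * fact (m + j)"
      using Suc by (intro mult_mono) auto
    finally show ?case by simp
  qed simp
  from this[of "k - m"] have "fact m * m ^ (k - m) \<le> (fact k :: nat)"
    using True by simp
  then have "(fact m * m ^ (k - m)) * m ^ m \<le> fact k * m ^ m"
    by (rule mult_right_mono) simp
  then show ?thesis
    using True by (simp add: mult.assoc power_add[symmetric])
next
  case False
  have "fact (k + j) \<le> fact k * m ^ j" if "k + j \<le> m" for j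
    using that
  proof (induction j)
    case (Suc j)
    have "fact (k + Suc j) = Suc (k + j) * (fact (k + j) :: nat)" by simp
    also have "\<dots> \<le> m * (fact k * m ^ j)"
      using Suc by (intro mult_mono) auto
    finally show ?case by (simp add: mult_ac)
  qed simp
  from this[of "m - k"] have "fact m \<le> fact k * m ^ (m - k)"
    using False by simp
  then have "fact m * m ^ k \<le> (fact k * m ^ (m - k)) * m ^ k"
    by (rule mult_right_mono) simp
  then show ?thesis
    using False by (simp add: mult.assoc power_add[symmetric])
qed

text \<open>The $N + 1$ binomial probabilities add up to 1, and the one at $L$ is the largest.\<close>

lemma binomial_mode:
  assumes L: "L \<le> N" and N: "N > 0"
  shows "1 \<le> (real N + 1) * (real (N choose L) * (L / N) ^ L * (1 - L / N) ^ (N - L))"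
proof -
  define b where "b k = real (N choose k) * (L / N) ^ k * (1 - L / N) ^ (N - k)" for k
  have le: "b k \<le> b L" if k: "k \<le> N" for k
  proof -
    define M where "M = N - L"
    \<comment> \<open>Up to a constant the binomial weight is a product of two Poisson weights, with
      parameters L and N - L, and both are maximal at j = L.\<close>
    have bk: "b j = fact N / N ^ N * (L ^ j / fact j) * (M ^ (N - j) / fact (N - j))" if "j \<le> N" for j
    proof -
      have "1 - L / N = M / N" using L N by (simp add: M_def of_nat_diff field_simps)
      moreover have "real N ^ N = real N ^ j * real N ^ (N - j)"
        using that by (simp add: power_add[symmetric])
      ultimately show ?thesis
        using that by (simp add: b_def binomial_fact power_divide)
    qed
    have f: "real m ^ j / fact j \<le> real m ^ m / fact m" for m j :: nat
    proof -
      have "real (fact m * m ^ j) \<le> real (fact j * m ^ m)"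
        using fact_mult_power_le by (rule of_nat_mono)
      then show ?thesis by (simp add: field_simps)
    qed
    have "N - L = M" by (simp add: M_def)
    then show ?thesis
      unfolding bk[OF k] bk[OF L] mult.assoc using f[of L k] f[of M "N - k"]
      by (intro mult_left_mono mult_mono) auto
  qed
  have "1 = (L / N + (1 - L / N)) ^ N" by simp
  also have "\<dots> = (\<Sum>k\<le>N. b k)"
    unfolding b_def by (rule binomial_ring)
  also have "\<dots> \<le> (\<Sum>k\<le>N. b L)"
    by (intro sum_mono le) auto
  also have "\<dots> = (real N + 1) * b L" by simp
  finally show ?thesis by (simp add: b_def)
qed

section \<open>The uniform graph with L edges\<close>

lemma mic_edges_eq:
  "mic_edges n L = pmf_of_set {g \<in> graphs n. card g = L}"
proof -
  have "{g \<in> graphs n. \<forall>i\<in>{1..1}. edge_constraint n g i = real L} = {g \<in> graphs n. card g = L}"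
    by (auto simp: edge_constraint_eq)
  then show ?thesis by (simp add: mic_edges_def microcanonical_def)
qed

text \<open>Such a graph amounts to a choice of the remaining edges outside F. For
  \<open>card F > L\<close> the truncated difference would be 0 and the binomial coefficient 1,
  although there is no such graph.\<close>

lemma card_graphs_with_edges:
  assumes F: "F \<subseteq> nsets {1..n} 2" and L: "card F \<le> L"
  shows "card {g \<in> graphs n. F \<subseteq> g \<and> card g = L} = ((n choose 2) - card F) choose (L - card F)"
proof -
  let ?E = "nsets {1..n} 2"
  have finF: "finite F" using F finite_pairs finite_subset by blast
  have "bij_betw (\<lambda>g. g - F) {g \<in> graphs n. F \<subseteq> g \<and> card g = L} {B. B \<subseteq> ?E - F \<and> card B = L - card F}"
  proof (rule bij_betw_byWitness[where f' = "\<lambda>B. B \<union> F"])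
    show "(\<lambda>g. g - F) ` {g \<in> graphs n. F \<subseteq> g \<and> card g = L} \<subseteq> {B. B \<subseteq> ?E - F \<and> card B = L - card F}"
      using finF by (auto simp: graphs_def card_Diff_subset)
    have "card (B \<union> F) = L" if "B \<subseteq> ?E - F" "card B = L - card F" for B
    proof -
      have "finite B" using that finite_pairs finite_subset by blast
      then show ?thesis using that finF L by (subst card_Un_disjoint) auto
    qed
    then show "(\<lambda>B. B \<union> F) ` {B. B \<subseteq> ?E - F \<and> card B = L - card F} \<subseteq> {g \<in> graphs n. F \<subseteq> g \<and> card g = L}"
      using F by (auto simp: graphs_def)
  qed auto
  then have "card {g \<in> graphs n. F \<subseteq> g \<and> card g = L} = card {B. B \<subseteq> ?E - F \<and> card B = L - card F}"
    by (rule bij_betw_same_card)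
  also have "\<dots> = card (?E - F) choose (L - card F)"
    using finite_pairs by (intro n_subsets) simp
  finally show ?thesis
    using F finF by (simp add: card_Diff_subset card_pairs)
qed

lemma card_graphs_edges: "card {g \<in> graphs n. card g = L} = (n choose 2) choose L"
  using card_graphs_with_edges[of "{}" n L] by simp

lemma graphs_edges_nonempty:
  assumes "L \<le> n choose 2"
  shows "{g \<in> graphs n. card g = L} \<noteq> {}"
proof -
  have "card {g \<in> graphs n. card g = L} > 0"
    using assms by (simp add: card_graphs_edges)
  then show ?thesis by (metis card.empty less_irrefl)
qed

lemma finite_graphs_edges: "finite {g \<in> graphs n. card g = L}"
  using finite_graphs by simp

lemma set_pmf_mic_edges:
  assumes "L \<le> n choose 2"
  shows "set_pmf (mic_edges n L) \<subseteq> graphs n"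
  using graphs_edges_nonempty[OF assms] finite_graphs_edges by (auto simp: mic_edges_eq)

lemma expectation_mic_edges_subset:
  assumes L: "L \<le> n choose 2" and F: "F \<subseteq> nsets {1..n} 2"
  shows "measure_pmf.expectation (mic_edges n L) (\<lambda>g. if F \<subseteq> g then 1 else 0)
    = (if card F \<le> L then real (((n choose 2) - card F) choose (L - card F)) / real ((n choose 2) choose L) else 0)"
proof -
  let ?G = "{g \<in> graphs n. card g = L}"
  have "measure_pmf.expectation (mic_edges n L) (\<lambda>g. if F \<subseteq> g then 1 else 0)
      = (\<Sum>g\<in>?G. if F \<subseteq> g then 1 else 0) / card ?G"
    unfolding mic_edges_eq
    by (rule integral_pmf_of_set[OF graphs_edges_nonempty[OF L] finite_graphs_edges])
  also have "\<dots> = real (card {g \<in> graphs n. F \<subseteq> g \<and> card g = L}) / real ((n choose 2) choose L)"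
  proof -
    have "?G \<inter> {g. F \<subseteq> g} = {g \<in> graphs n. F \<subseteq> g \<and> card g = L}" by auto
    then show ?thesis
      using finite_graphs_edges[of n L] by (simp only: sum.If_cases card_graphs_edges) simp
  qed
  also have "\<dots> = (if card F \<le> L then real (((n choose 2) - card F) choose (L - card F))
      / real ((n choose 2) choose L) else 0)"
  proof (cases "card F \<le> L")
    case True
    then show ?thesis by (simp add: card_graphs_with_edges[OF F])
  next
    case False
    then have "{g \<in> graphs n. F \<subseteq> g \<and> card g = L} = {}"
      using card_mono[OF finite_graph] by fastforce
    then show ?thesis using False by (simp del: Collect_empty_eq)
  qed
  finally show ?thesis .
qed

lemma choose_pred_ratio:
  assumes "1 \<le> L" "L \<le> N"
  shows "real ((N - 1) choose (L - 1)) / real (N choose L) = L / N"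
proof -
  have "L * (N choose L) = N * ((N - 1) choose (L - 1))"
    using binomial_absorption[of "L - 1" N] assms by simp
  then have "real L * real (N choose L) = real N * real ((N - 1) choose (L - 1))"
    by (metis of_nat_mult)
  then show ?thesis using assms by (simp add: field_simps)
qed

lemma mic_edges_one_edge:
  assumes L: "L \<le> n choose 2" and e: "e \<in> nsets {1..n} 2"
  shows "measure_pmf.expectation (mic_edges n L) (\<lambda>g. if e \<in> g then 1 else 0) = L / (n choose 2)"
  using expectation_mic_edges_subset[OF L, of "{e}"] e choose_pred_ratio[OF _ L]
  by (cases "L = 0") (auto simp: One_nat_def)

lemma mic_edges_two_edges:
  assumes L: "L \<le> n choose 2"
    and e: "e \<in> nsets {1..n} 2" and f: "f \<in> nsets {1..n} 2" and ne: "e \<noteq> f"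
  shows "measure_pmf.expectation (mic_edges n L) (\<lambda>g. if e \<in> g \<and> f \<in> g then 1 else 0)
    = L / (n choose 2) * (real (L - 1) / real ((n choose 2) - 1))"
proof -
  let ?N = "n choose 2"
  have c: "card {e, f} = 2" using ne by simp
  have "measure_pmf.expectation (mic_edges n L) (\<lambda>g. if e \<in> g \<and> f \<in> g then 1 else 0)
      = (if 2 \<le> L then real ((?N - 2) choose (L - 2)) / real (?N choose L) else 0)"
    using expectation_mic_edges_subset[OF L, of "{e, f}"] e f unfolding c by simp
  also have "\<dots> = L / ?N * (real (L - 1) / real (?N - 1))"
  proof (cases "2 \<le> L")
    case True
    have r1: "real ((?N - 2) choose (L - 2)) / real ((?N - 1) choose (L - 1)) = real (L - 1) / real (?N - 1)"
      using choose_pred_ratio[of "L - 1" "?N - 1"] True L by (simp add: numeral_2_eq_2 One_nat_def)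
    have r2: "real ((?N - 1) choose (L - 1)) / real (?N choose L) = L / ?N"
      using choose_pred_ratio[of L ?N] True L by simp
    have "real ((?N - 1) choose (L - 1)) \<noteq> 0"
      using True L by (simp add: binomial_eq_0_iff)
    then have "real ((?N - 2) choose (L - 2)) / real (?N choose L)
        = real ((?N - 1) choose (L - 1)) / real (?N choose L)
          * (real ((?N - 2) choose (L - 2)) / real ((?N - 1) choose (L - 1)))"
      by simp
    then show ?thesis
      unfolding r1 r2 using True by simp
  next
    case False
    \<comment> \<open>The truncation of \<open>L - 1\<close> at L = 0 is harmless, because the
      factor L vanishes there; for L = 1 the factor \<open>L - 1\<close> does.\<close>
    then have "L = 0 \<or> L = 1" by auto
    then show ?thesis by auto
  qed
  finally show ?thesis by simp
qed

text \<open>The Erdos--Renyi mass is constant on the graphs with L edges, so the ratio of the two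
  laws there is the inverse of the binomial probability of L.\<close>

lemma pmf_mic_edges_le:
  assumes n: "n \<ge> 2" and L: "L \<le> n choose 2"
  shows "pmf (mic_edges n L) g
    \<le> (real (n choose 2) + 1) * pmf (erdos_renyi n (real L / real (n choose 2))) g"
proof (cases "g \<in> {g \<in> graphs n. card g = L}")
  case True
  let ?N = "n choose 2"
  have N: "?N > 0" using n by (simp add: zero_less_binomial)
  have C: "real (?N choose L) > 0" using L by simp
  have "pmf (mic_edges n L) g = 1 / real (?N choose L)"
    using True unfolding mic_edges_eq
    by (subst pmf_of_set[OF graphs_edges_nonempty[OF L] finite_graphs_edges]) (simp add: card_graphs_edges)
  moreover have "pmf (erdos_renyi n (real L / real ?N)) g = (L / ?N) ^ L * (1 - L / ?N) ^ (?N - L)"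
    using True L N by (subst pmf_erdos_renyi_card) auto
  ultimately show ?thesis
    using binomial_mode[OF L N] C by (simp add: pos_divide_le_eq mult_ac)
next
  case False
  then have "pmf (mic_edges n L) g = 0"
    unfolding mic_edges_eq
    by (subst pmf_of_set[OF graphs_edges_nonempty[OF L] finite_graphs_edges]) simp
  then show ?thesis by simp
qed

lemma measure_mic_edges_le:
  assumes n: "n \<ge> 2" and L: "L \<le> n choose 2"
  shows "measure_pmf.prob (mic_edges n L) B
    \<le> (real (n choose 2) + 1) * measure_pmf.prob (erdos_renyi n (real L / real (n choose 2))) B"
proof -
  have fin: "measure_pmf.prob M B = (\<Sum>g\<in>graphs n \<inter> B. pmf M g)" if "set_pmf M \<subseteq> graphs n" for M
  proof -
    have "measure_pmf.prob M B = measure_pmf.prob M (graphs n \<inter> B)"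
      using that by (intro measure_prob_cong_0) (auto simp: set_pmf_iff)
    then show ?thesis
      using finite_graphs by (simp add: measure_measure_pmf_finite)
  qed
  show ?thesis
    unfolding fin[OF set_pmf_mic_edges[OF L]] fin[OF set_pmf_erdos_renyi] sum_distrib_left
    by (intro sum_mono pmf_mic_edges_le[OF n L])
qed

section \<open>Expected largest eigenvalue\<close>

text \<open>The trace exponents must be built from powers of two; this is the first such power to
  reach ln n, and for ln n >= 1 it overshoots by a factor of at most two.\<close>

definition dyadic_log :: "nat \<Rightarrow> nat" where
  "dyadic_log n = (LEAST r. ln (real n) \<le> 2 ^ r)"

text \<open>Badness is expressed by the trace, to which Markov's inequality applies directly, rather
  than by the norm. The threshold is the matching power of h = D / ln n.\<close>

definition bad_graphs :: "nat \<Rightarrow> real \<Rightarrow> graph set" where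
  "bad_graphs n q = {g. trace_pow {1..n} (centred q g) (2 * 2 ^ dyadic_log n)
     > (q * (real n - 1) / ln n) ^ (2 * 2 ^ dyadic_log n)}"

text \<open>Put \<delta> = 1 / ln n and h = \<delta> D. The first summand stems from the upper
  bound, where the mean degree minus h is at least (1 - 2 \<delta>) D; the second from the factor in
  the lower bound, with q / D = 1 / (n - 1); the third covers the bad graphs.\<close>

definition eigenvalue_err :: "nat \<Rightarrow> real" where
  "eigenvalue_err n = (1 / (1 - 2 / ln n) - 1)
     + (1 - (1 - 2 / ln n - 1 / (real n - 1)) / (1 + (1 / ln n)\<^sup>2)) + 1 / real n ^ 5"

lemma dyadic_log_bounds:
  assumes "ln (real n) \<ge> 1"
  shows "ln (real n) \<le> 2 ^ dyadic_log n" "2 ^ dyadic_log n \<le> 2 * ln (real n)"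
proof -
  obtain r where "ln (real n) < 2 ^ r"
    using real_arch_pow[of 2 "ln (real n)"] by auto
  then show "ln (real n) \<le> 2 ^ dyadic_log n"
    unfolding dyadic_log_def by (intro LeastI[of "\<lambda>r. ln (real n) \<le> 2 ^ r" r] less_imp_le)
  show "2 ^ dyadic_log n \<le> 2 * ln (real n)"
  proof (cases "dyadic_log n")
    case 0
    then show ?thesis using assms by simp
  next
    case (Suc r)
    then have "r < (LEAST r. ln (real n) \<le> 2 ^ r)"
      by (simp add: dyadic_log_def)
    from not_less_Least[OF this] have "\<not> ln (real n) \<le> 2 ^ r" .
    then show ?thesis by (simp add: Suc)
  qed
qed

text \<open>Markov's inequality for the trace. Write l = ln n, h = D / l. As K <= 2 l and D >= l^6 /
  4, the base 8 K n q / h^2 is at most 32 l^3 / D <= 128 / l^3, which the threshold 128 exp 10 for l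
  pushes below exp (-10). Since K >= l, its K-th power is at most n^-10, and the n starting points
  of the walks use up one power.\<close>

lemma prob_bad_graphs_erdos_renyi:
  fixes q :: real
  assumes n: "n \<ge> 2" and big: "ln (real n) \<ge> 128 * exp 10"
    and q: "0 < q" "q \<le> 1" and dense: "ln (real n) ^ 6 / 2 \<le> n * q"
  shows "measure_pmf.prob (erdos_renyi n q) (bad_graphs n q) \<le> 1 / real n ^ 9"
proof -
  define K where "K = (2 :: nat) ^ dyadic_log n"
  define l where "l = ln (real n)"
  define D where "D = q * (real n - 1)"
  define T where "T g = trace_pow {1..n} (centred q g) (2 * K)" for g
  have e10: "exp 10 \<ge> (1 :: real)" by simp
  have l: "l \<ge> 128 * exp 10" "l \<ge> 128" using big e10 unfolding l_def by linarith+
  have K: "l \<le> K" "K \<le> 2 * l" "K \<ge> 1"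
    using dyadic_log_bounds[of n] l by (simp_all add: K_def l_def)
  have D: "D > 0" "n * q \<le> 2 * D"
    using n q by (auto simp: D_def of_nat_diff)
  have l6: "l ^ 6 \<le> 4 * D" using dense D by (simp add: l_def)
  \<comment> \<open>Equivalent to 4 l <= l^6 / 2, which puts 2 K below n q as the trace bound
    requires.\<close>
  have l5: "l * 8 \<le> l ^ 6"
  proof -
    have "(8 :: real) \<le> l ^ 1" using l by simp
    also have "\<dots> \<le> l ^ 5" using l by (intro power_increasing) auto
    finally have "l * 8 \<le> l * l ^ 5" using l by (intro mult_left_mono) auto
    then show ?thesis by (simp add: power_Suc[symmetric])
  qed
  have Kq: "2 * real K \<le> n * q"
    using K l5 dense by (simp add: l_def)
  let ?c = "(D / l) ^ (2 * K)"
  have c: "?c > 0" using D l by simp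
  have "bad_graphs n q \<subseteq> {g. T g \<ge> ?c}"
    by (auto simp: bad_graphs_def T_def K_def D_def l_def)
  then have "measure_pmf.prob (erdos_renyi n q) (bad_graphs n q)
      \<le> measure_pmf.prob (erdos_renyi n q) {g \<in> space (measure_pmf (erdos_renyi n q)). T g \<ge> ?c}"
    by (intro measure_pmf.finite_measure_mono) auto
  also have "\<dots> \<le> measure_pmf.expectation (erdos_renyi n q) T / ?c"
    using c integrable_graph_pmf[OF set_pmf_erdos_renyi]
    by (intro integral_Markov_inequality_measure[where A = "{}"])
      (auto simp: T_def intro!: trace_pow_even_nonneg centred_sym AE_pmfI)
  also have "\<dots> \<le> n * (8 * K * n * q) ^ K / ?c"
    using expectation_trace_pow_le[OF q K(3) Kq] c unfolding T_def
    by (intro divide_right_mono) simp_all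
  also have "\<dots> = n * (8 * K * n * q / (D / l)\<^sup>2) ^ K"
    by (simp add: power_mult power_divide power_mult_distrib)
  also have "\<dots> \<le> n * (exp (- 10)) ^ K"
  proof (intro mult_left_mono power_mono)
    have "8 * K * n * q / (D / l)\<^sup>2 = 8 * K * (n * q) * l\<^sup>2 / D\<^sup>2"
      using l by (simp add: field_simps)
    also have "\<dots> \<le> 8 * (2 * l) * (2 * D) * l\<^sup>2 / D\<^sup>2"
    proof (rule divide_right_mono)
      have "8 * real K * (n * q) \<le> 8 * (2 * l) * (2 * D)"
        using K D q l by (intro mult_mono[of "8 * real K" "8 * (2 * l)" "n * q" "2 * D"]) auto
      from mult_right_mono[OF this, of "l\<^sup>2"]
      show "8 * K * (n * q) * l\<^sup>2 \<le> 8 * (2 * l) * (2 * D) * l\<^sup>2" by simp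
    qed simp
    also have "\<dots> = 32 * l ^ 3 / D"
      using D by (simp add: power2_eq_square power3_eq_cube)
    also have "\<dots> \<le> exp (- 10)"
    proof -
      have "128 * exp 10 * l ^ 3 \<le> l ^ 3 * l ^ 3"
      proof (rule mult_right_mono)
        have "l ^ 1 \<le> l ^ 3" using l by (intro power_increasing) auto
        then show "128 * exp 10 \<le> l ^ 3" using l by simp
      qed (use l in simp)
      also have "\<dots> = l ^ 6" by (simp add: power_add[symmetric])
      finally have "128 * exp 10 * l ^ 3 \<le> 4 * D" using l6 by linarith
      moreover have "32 * l ^ 3 * exp 10 = 128 * exp 10 * l ^ 3 / 4" by simp
      ultimately have "32 * l ^ 3 * exp 10 \<le> D" by linarith
      then show ?thesis
        using D by (simp add: exp_minus field_simps)
    qed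
    finally show "8 * K * n * q / (D / l)\<^sup>2 \<le> exp (- 10)" .
  qed (use q in auto)
  also have "\<dots> = n * exp (- 10 * real K)"
    by (simp add: exp_of_nat_mult[symmetric] mult.commute)
  also have "\<dots> \<le> n * exp (- 10 * l)"
    using K by (intro mult_left_mono) auto
  also have "exp (- 10 * l) = 1 / real n ^ 10"
  proof -
    have "exp (10 * l) = real n ^ 10"
      using n exp_of_nat_mult[of 10 l] by (simp add: l_def)
    then show ?thesis by (simp add: exp_minus field_simps)
  qed
  also have "n * (1 / real n ^ 10) = 1 / real n ^ 9"
    using n by (simp add: power_eq_if[of _ 10])
  finally show ?thesis .
qed

lemma mean_deg_bounds:
  assumes "n \<ge> 1"
  shows "0 \<le> mean_deg n g" "mean_deg n g \<le> n"
proof -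
  show "0 \<le> mean_deg n g"
    by (simp add: mean_deg_def deg_nonneg sum_nonneg)
  have "(\<Sum>i\<in>{1..n}. deg n g i) \<le> (\<Sum>i\<in>{1..n}. real n)"
    by (intro sum_mono deg_le)
  then show "mean_deg n g \<le> n"
    using assms by (simp add: mean_deg_def pos_divide_le_eq)
qed

lemma deg_var_le_sq:
  assumes "n \<ge> 1"
  shows "deg_var n g \<le> (real n)\<^sup>2"
proof -
  have "(deg n g i - mean_deg n g)\<^sup>2 \<le> (real n)\<^sup>2" for i
    using deg_le[of n g i] deg_nonneg[of n g i] mean_deg_bounds[OF assms, of g]
    by (intro power2_le_iff_abs_le[THEN iffD2]) auto
  then have "(\<Sum>i\<in>{1..n}. (deg n g i - mean_deg n g)\<^sup>2) \<le> (\<Sum>i\<in>{1..n}. (real n)\<^sup>2)"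
    by (intro sum_mono)
  then show ?thesis
    using assms by (simp add: deg_var_def pos_divide_le_eq mult.commute)
qed

lemma good_graph_operator_norm:
  assumes "g \<notin> bad_graphs n q"
  shows "(\<Sum>i\<in>{1..n}. (mat_op {1..n} (centred q g) x i)\<^sup>2)
    \<le> (q * (real n - 1) / ln n)\<^sup>2 * (\<Sum>i\<in>{1..n}. (x i)\<^sup>2)"
  using assms by (intro mat_op_norm_le[where r = "dyadic_log n"] centred_sym) (auto simp: bad_graphs_def)

text \<open>Stated for any law with given probabilities for one and two edges and a rare bad event,
  so that it serves both ensembles. The deterministic bounds on good graphs are completed by
  indicator terms and then integrated term by term.\<close>

lemma expected_largest_eigenvalue:
  fixes M :: "graph pmf" and q r :: real
  assumes n: "n \<ge> 2" and big: "ln (real n) \<ge> 4"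
    and q: "0 < q" "q \<le> 1" and D1: "q * (real n - 1) \<ge> 1"
    and supp: "set_pmf M \<subseteq> graphs n"
    and one: "\<And>e. e \<in> nsets {1..n} 2 \<Longrightarrow>
      measure_pmf.expectation M (\<lambda>g. if e \<in> g then 1 else 0) = q"
    and two: "\<And>e f. e \<in> nsets {1..n} 2 \<Longrightarrow> f \<in> nsets {1..n} 2 \<Longrightarrow> e \<noteq> f \<Longrightarrow>
      measure_pmf.expectation M (\<lambda>g. if e \<in> g \<and> f \<in> g then 1 else 0) = r"
    and r: "0 \<le> r" "r \<le> q"
    and bad: "measure_pmf.prob M (bad_graphs n q) \<le> 1 / real n ^ 7"
  shows "\<bar>measure_pmf.expectation M (largest_eigenvalue n) - q * (real n - 1)
    - (real n - 2) / n * (1 - r / q)\<bar> \<le> eigenvalue_err n"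
proof -
  define D where "D = q * (real n - 1)"
  define \<delta> where "\<delta> = 1 / ln (real n)"
  \<comment> \<open>The expectation of \<open>deg_var n / D\<close>.\<close>
  define V where "V = (real n - 2) / n * (1 - r / q)"
  \<comment> \<open>The factor of the lower bound with \<open>deg_var n g / D\<^sup>2\<close>
    replaced by its bound \<open>\<delta>\<^sup>2\<close>, so that it no longer depends on the
    graph.\<close>
  define c where "c = (1 - 2 * \<delta> - 1 / (real n - 1)) / (1 + \<delta>\<^sup>2)"
  define E :: "(graph \<Rightarrow> real) \<Rightarrow> real" where "E = measure_pmf.expectation M"
  define p where "p = measure_pmf.prob M (bad_graphs n q)"
  define B where "B = (indicator (bad_graphs n q) :: graph \<Rightarrow> real)"
  have n1: "n \<ge> 1" using n by simp
  have D: "D \<ge> 1" using D1 unfolding D_def .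
  have \<delta>: "0 < \<delta>" "\<delta> \<le> 1 / 4" using big by (auto simp: \<delta>_def field_simps)
  have n2: "n \<ge> 4"
  proof (rule ccontr)
    assume "\<not> n \<ge> 4"
    then have "real n \<le> 3" by simp
    moreover have "ln (real n) \<le> real n - 1" using n by (intro ln_le_minus_one) simp
    ultimately show False using big by linarith
  qed
  have qD: "q / D = 1 / (real n - 1)" using q by (simp add: D_def)
  have n3: "0 \<le> 1 / (real n - 1)" "1 / (real n - 1) \<le> 1 / 2"
    using n2 by (simp_all add: divide_le_eq)
  have num: "0 \<le> 1 - 2 * \<delta> - 1 / (real n - 1)"
    using n3 \<delta> by linarith
  have pos1: "0 < 1 + \<delta>\<^sup>2"
    by (rule add_pos_nonneg) simp_all
  have c: "0 \<le> c" "c \<le> 1"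
  proof -
    show "0 \<le> c"
      unfolding c_def by (rule divide_nonneg_pos[OF num pos1])
    have "0 \<le> \<delta>\<^sup>2" by simp
    then have "1 - 2 * \<delta> - 1 / (real n - 1) \<le> 1 + \<delta>\<^sup>2"
      using \<delta> n3 by linarith
    then show "c \<le> 1"
      unfolding c_def divide_le_eq_1_pos[OF pos1] .
  qed
  have int: "integrable (measure_pmf M) f" for f :: "graph \<Rightarrow> real"
    by (rule integrable_graph_pmf[OF supp])
  have Emean: "E (mean_deg n) = D"
    using expectation_mean_deg[OF n1 supp one two] n1 by (simp add: E_def D_def of_nat_diff)
  have Evar: "E (deg_var n) = D * V"
  proof -
    have "E (deg_var n) = (real n - 1) * (real n - 2) / n * (q - r)"
      unfolding E_def by (rule expectation_deg_var[OF n1 supp one two])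
    also have "q - r = q * (1 - r / q)"
      using q by (simp add: right_diff_distrib)
    finally show ?thesis by (simp add: D_def V_def)
  qed
  have EB: "E B = p" by (simp add: E_def B_def p_def)
  have V: "0 \<le> V" "V \<le> 1"
  proof -
    have a: "0 \<le> 1 - r / q" "1 - r / q \<le> 1" using r q by auto
    have b: "0 \<le> (real n - 2) / n" "(real n - 2) / n \<le> 1" using n by auto
    show "0 \<le> V" unfolding V_def using a b by (intro mult_nonneg_nonneg)
    have "V \<le> 1 * 1" unfolding V_def using a b by (intro mult_mono) auto
    then show "V \<le> 1" by simp
  qed
  have hD: "q * (real n - 1) / ln n = \<delta> * D" by (simp add: \<delta>_def D_def)
  have h0: "0 \<le> \<delta> * D" using \<delta> D by simp
  \<comment> \<open>On a bad graph the other terms are nonnegative and the indicator term alone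
    reaches the trivial bound n.\<close>
  have upper: "largest_eigenvalue n g \<le> mean_deg n g + deg_var n g / ((1 - 2 * \<delta>) * D) + n * B g"
    if g: "g \<in> graphs n" for g
  proof (cases "g \<in> bad_graphs n q")
    case True
    have "0 \<le> mean_deg n g + deg_var n g / ((1 - 2 * \<delta>) * D)"
      using mean_deg_bounds[OF n1] deg_var_nonneg \<delta> D
      by (intro add_nonneg_nonneg divide_nonneg_nonneg mult_nonneg_nonneg) auto
    then show ?thesis
      using True largest_eigenvalue_le_n[OF n1, of g] by (simp add: B_def)
  next
    case False
    note op = good_graph_operator_norm[OF False, unfolded hD]
    have close: "\<bar>mean_deg n g - D\<bar> \<le> \<delta> * D"
      using mean_deg_close[OF n1 g h0 op] n1 by (simp add: D_def of_nat_diff)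
    have gap: "(1 - 2 * \<delta>) * D \<le> mean_deg n g - \<delta> * D"
      using close by (simp add: algebra_simps abs_le_iff)
    have pos: "0 < (1 - 2 * \<delta>) * D" using \<delta> D by simp
    have mD: "\<delta> * D < mean_deg n g" using gap pos by linarith
    then have "largest_eigenvalue n g \<le> mean_deg n g + deg_var n g / (mean_deg n g - \<delta> * D)"
      using q by (intro largest_eigenvalue_upper[OF n1 g h0 _ op]) auto
    also have "deg_var n g / (mean_deg n g - \<delta> * D) \<le> deg_var n g / ((1 - 2 * \<delta>) * D)"
      using gap mD deg_var_nonneg \<delta> D by (intro divide_left_mono mult_pos_pos) auto
    finally show ?thesis using False by (simp add: B_def)
  qed
  \<comment> \<open>On a bad graph the mean degree is still a lower bound, so only the variance
    term, at most n^2, has to be compensated.\<close>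
  have lower: "mean_deg n g + deg_var n g / D * c - (real n)\<^sup>2 * B g \<le> largest_eigenvalue n g"
    if g: "g \<in> graphs n" for g
  proof (cases "g \<in> bad_graphs n q")
    case True
    have "deg_var n g / D * c \<le> deg_var n g / D * 1"
      using c deg_var_nonneg D by (intro mult_left_mono divide_nonneg_nonneg) auto
    also have "\<dots> \<le> deg_var n g"
      using D deg_var_nonneg[of n g] by (simp add: divide_le_eq mult_le_cancel_left1)
    also have "\<dots> \<le> (real n)\<^sup>2" by (rule deg_var_le_sq[OF n1])
    finally show ?thesis
      using True mean_deg_le_largest_eigenvalue[OF n1, of g] by (simp add: B_def)
  next
    case False
    note op = good_graph_operator_norm[OF False, unfolded hD]
    have var: "deg_var n g / D\<^sup>2 \<le> \<delta>\<^sup>2"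
      using deg_var_le[OF n1 g op] D by (simp add: power_mult_distrib pos_divide_le_eq)
    have "deg_var n g / D * c
        = deg_var n g / D * (1 - 2 * (\<delta> * D) / D - q / D) / (1 + \<delta>\<^sup>2)"
      using D by (simp add: c_def qD)
    also have "\<dots> \<le> deg_var n g / D * (1 - 2 * (\<delta> * D) / D - q / D) / (1 + deg_var n g / D\<^sup>2)"
      using var num deg_var_nonneg[of n g] D
      by (intro divide_left_mono mult_nonneg_nonneg mult_pos_pos)
        (auto simp: qD add_pos_nonneg)
    also have "mean_deg n g + \<dots> \<le> largest_eigenvalue n g"
      using q D n1 by (intro largest_eigenvalue_lower[OF n1 g h0 _ op]) (auto simp: D_def of_nat_diff)
    finally show ?thesis using False by (simp add: B_def)
  qed
  have mono: "E f \<le> E h" if "\<And>g. g \<in> graphs n \<Longrightarrow> f g \<le> h g" for f h :: "graph \<Rightarrow> real"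
    unfolding E_def expectation_graph_pmf[OF supp]
    by (intro sum_mono mult_right_mono that) auto
  have np: "n * p \<le> 1 / real n ^ 5" "(real n)\<^sup>2 * p \<le> 1 / real n ^ 5"
  proof -
    have "(real n)\<^sup>2 * p \<le> (real n)\<^sup>2 * (1 / real n ^ 7)"
      using bad by (intro mult_left_mono) (auto simp: p_def)
    also have "\<dots> = 1 / real n ^ 5"
      using n by (simp add: power_eq_if[of _ 7] power_eq_if[of _ 6] power_eq_if[of _ 5] power2_eq_square)
    finally show sq: "(real n)\<^sup>2 * p \<le> 1 / real n ^ 5" .
    have "real n * p \<le> (real n)\<^sup>2 * p"
      using n by (intro mult_right_mono) (auto simp: p_def power2_eq_square)
    with sq show "n * p \<le> 1 / real n ^ 5" by linarith
  qed
  have "E (largest_eigenvalue n) \<le> E (\<lambda>g. mean_deg n g + deg_var n g / ((1 - 2 * \<delta>) * D) + n * B g)"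
    by (intro mono upper)
  also have "\<dots> = E (mean_deg n) + E (deg_var n) / ((1 - 2 * \<delta>) * D) + n * E B"
    unfolding E_def by (simp add: Bochner_Integration.integral_add[OF int int])
  also have "\<dots> = D + D * V / ((1 - 2 * \<delta>) * D) + n * p"
    by (simp only: Emean Evar EB)
  finally have up: "E (largest_eigenvalue n) \<le> D + V / (1 - 2 * \<delta>) + 1 / real n ^ 5"
    using np D by simp
  have "E (\<lambda>g. mean_deg n g + deg_var n g / D * c - (real n)\<^sup>2 * B g) \<le> E (largest_eigenvalue n)"
    by (intro mono lower)
  moreover have "E (\<lambda>g. mean_deg n g + deg_var n g / D * c - (real n)\<^sup>2 * B g)
      = E (mean_deg n) + E (deg_var n) / D * c - (real n)\<^sup>2 * E B"
    unfolding E_def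
    by (simp add: Bochner_Integration.integral_add[OF int int] Bochner_Integration.integral_diff[OF int int])
  ultimately have lo: "D + V * c - 1 / real n ^ 5 \<le> E (largest_eigenvalue n)"
    using np D by (simp add: Emean Evar EB)
  have "V / (1 - 2 * \<delta>) - V \<le> 1 / (1 - 2 * \<delta>) - 1"
  proof -
    have "1 / (1 - 2 * \<delta>) - 1 \<ge> 0" using \<delta> by simp
    then have "V * (1 / (1 - 2 * \<delta>) - 1) \<le> 1 / (1 - 2 * \<delta>) - 1"
      using V by (intro mult_left_le_one_le) auto
    then show ?thesis by (simp add: right_diff_distrib)
  qed
  moreover have "V * (1 - c) \<le> 1 - c"
    using V c by (intro mult_left_le_one_le) auto
  moreover have "eigenvalue_err n = (1 / (1 - 2 * \<delta>) - 1) + (1 - c) + 1 / real n ^ 5"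
    by (simp add: eigenvalue_err_def c_def \<delta>_def)
  moreover have "1 / (1 - 2 * \<delta>) - 1 \<ge> 0" using \<delta> by simp
  ultimately have "\<bar>E (largest_eigenvalue n) - D - V\<bar> \<le> eigenvalue_err n"
    using up lo c by (simp add: abs_le_iff right_diff_distrib)
  then show ?thesis by (simp add: E_def D_def V_def)
qed

lemma eigenvalue_err_tendsto_0: "eigenvalue_err \<longlonglongrightarrow> 0"
  unfolding eigenvalue_err_def[abs_def] by real_asymp

section \<open>Asymptotics\<close>

lemma dense_average_degree:
  fixes q :: real
  assumes n: "n \<ge> 2" and big: "ln (real n) \<ge> 128 * exp 10"
    and q: "0 < q" and dense: "ln (real n) ^ 6 / 2 \<le> n * q"
  shows "q * (real n - 1) \<ge> 1"
proof -
  have "exp 10 \<ge> (1 :: real)" by simp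
  then have l: "ln (real n) \<ge> 128" using big by linarith
  then have "ln (real n) ^ 1 \<le> ln (real n) ^ 6" by (intro power_increasing) auto
  then have "n * q \<ge> 64" using dense l by simp
  moreover have "q * (real n - 1) \<ge> n * q / 2"
    using n q by (simp add: of_nat_diff field_simps)
  ultimately show ?thesis by linarith
qed

lemma expected_largest_eigenvalue_erdos_renyi:
  fixes q :: real
  assumes n: "n \<ge> 2" and big: "ln (real n) \<ge> 128 * exp 10"
    and q: "0 < q" "q \<le> 1" and dense: "ln (real n) ^ 6 / 2 \<le> n * q"
  shows "\<bar>measure_pmf.expectation (erdos_renyi n q) (largest_eigenvalue n) - q * (real n - 1)
    - (real n - 2) / n * (1 - q)\<bar> \<le> eigenvalue_err n"
proof -
  have "exp 10 \<ge> (1 :: real)" by simp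
  then have l: "ln (real n) \<ge> 4" using big by linarith
  have "measure_pmf.prob (erdos_renyi n q) (bad_graphs n q) \<le> 1 / real n ^ 9"
    by (rule prob_bad_graphs_erdos_renyi[OF assms])
  also have "\<dots> \<le> 1 / real n ^ 7"
    using n by (intro divide_left_mono power_increasing) auto
  finally have bad: "measure_pmf.prob (erdos_renyi n q) (bad_graphs n q) \<le> 1 / real n ^ 7" .
  have "q\<^sup>2 \<le> q" using q by (simp add: power2_eq_square mult_le_cancel_left1)
  then show ?thesis
    using expected_largest_eigenvalue[OF n l q dense_average_degree[OF n big q(1) dense]
      set_pmf_erdos_renyi erdos_renyi_one_edge erdos_renyi_two_edges _ _ bad] q
    by (simp add: power2_eq_square)
qed

text \<open>Here r / q is the conditional probability of a second edge given a first one, for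
  sampling without replacement. The change of measure uses up two of the nine powers of n.\<close>

lemma expected_largest_eigenvalue_mic_edges:
  fixes q :: real
  assumes n: "n \<ge> 2" and big: "ln (real n) \<ge> 128 * exp 10" and L: "1 \<le> L" "L \<le> n choose 2"
    and q_def: "q = real L / real (n choose 2)" and dense: "ln (real n) ^ 6 / 2 \<le> n * q"
  shows "\<bar>measure_pmf.expectation (mic_edges n L) (largest_eigenvalue n) - q * (real n - 1)
    - (real n - 2) / n * (1 - real (L - 1) / real ((n choose 2) - 1))\<bar> \<le> eigenvalue_err n"
proof -
  let ?N = "n choose 2"
  define r where "r = q * (real (L - 1) / real (?N - 1))"
  have "exp 10 \<ge> (1 :: real)" by simp
  then have l: "ln (real n) \<ge> 4" using big by linarith
  have N: "?N > 0" using n by (simp add: zero_less_binomial)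
  have q: "0 < q" "q \<le> 1" using L N by (auto simp: q_def)
  have "measure_pmf.prob (mic_edges n L) (bad_graphs n q)
      \<le> (real ?N + 1) * measure_pmf.prob (erdos_renyi n q) (bad_graphs n q)"
    unfolding q_def by (rule measure_mic_edges_le[OF n L(2)])
  also have "\<dots> \<le> (real n)\<^sup>2 * (1 / real n ^ 9)"
  proof (intro mult_mono prob_bad_graphs_erdos_renyi[OF n big q dense])
    have "real n * 2 \<le> real n * real n" using n by (intro mult_left_mono) auto
    moreover have "real ?N = (real n * real n - real n) / 2"
      by (simp add: real_choose_two algebra_simps)
    moreover have "real n \<ge> 2" using n by simp
    ultimately show "real ?N + 1 \<le> (real n)\<^sup>2"
      unfolding power2_eq_square by argo
  qed auto
  also have "\<dots> = 1 / real n ^ 7"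
    using n by (simp add: power_eq_if[of _ 9] power_eq_if[of _ 8] power2_eq_square)
  finally have bad: "measure_pmf.prob (mic_edges n L) (bad_graphs n q) \<le> 1 / real n ^ 7" .
  have ratio: "real (L - 1) / real (?N - 1) \<le> 1"
  proof -
    have "real (L - 1) / real (?N - 1) \<le> real (?N - 1) / real (?N - 1)"
      using L by (intro divide_right_mono) (simp_all add: of_nat_mono diff_le_mono)
    also have "\<dots> \<le> 1" by (simp only: divide_self_if) simp
    finally show ?thesis .
  qed
  have r: "0 \<le> r" "r \<le> q"
    using q mult_left_mono[OF ratio, of q] by (auto simp: r_def)
  have "r / q = real (L - 1) / real (?N - 1)" using q by (simp add: r_def)
  moreover have "measure_pmf.expectation (mic_edges n L) (\<lambda>g. if e \<in> g then 1 else 0) = q"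
    if "e \<in> nsets {1..n} 2" for e
    unfolding q_def by (rule mic_edges_one_edge[OF L(2) that])
  moreover have "measure_pmf.expectation (mic_edges n L) (\<lambda>g. if e \<in> g \<and> f \<in> g then 1 else 0) = r"
    if "e \<in> nsets {1..n} 2" "f \<in> nsets {1..n} 2" "e \<noteq> f" for e f
    unfolding r_def q_def by (rule mic_edges_two_edges[OF L(2) that])
  ultimately show ?thesis
    using expected_largest_eigenvalue[OF n l q dense_average_degree[OF n big q(1) dense]
      set_pmf_mic_edges[OF L(2)] _ _ r bad] by simp
qed

lemma eventually_ln_large: "\<forall>\<^sub>F n in sequentially. ln (real n) \<ge> 128 * exp 10"
proof -
  have "filterlim (\<lambda>n. ln (real n)) at_top sequentially" by real_asymp
  then show ?thesis by (auto simp: filterlim_at_top)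
qed

text \<open>Since \<beta> > 6, p already satisfies n p >= (ln n)^6 eventually; the factor 1/2 pays
  for passing from p to q, whose ratio eventually exceeds 1/2.\<close>

lemma eventually_dense:
  fixes p q :: "nat \<Rightarrow> real"
  assumes p_range: "\<And>n. n \<ge> 1 \<Longrightarrow> 0 < p n \<and> p n < 1"
    and p_bounds: "\<exists>\<beta>>6. \<forall>\<^sub>F n in sequentially.
      ln (real n) powr \<beta> / real n \<le> p n \<and> p n < 1 - ln (real n) powr \<beta> / real n"
    and lim: "(\<lambda>n. q n / p n) \<longlonglongrightarrow> 1"
  shows "\<forall>\<^sub>F n in sequentially. 0 < q n \<and> ln (real n) ^ 6 / 2 \<le> n * q n"
proof -
  obtain \<beta> where \<beta>: "\<beta> > 6" and ev: "\<forall>\<^sub>F n in sequentially.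
      ln (real n) powr \<beta> / real n \<le> p n \<and> p n < 1 - ln (real n) powr \<beta> / real n"
    using p_bounds by blast
  have "\<forall>\<^sub>F n in sequentially. q n / p n > 1 / 2"
    using lim by (rule order_tendstoD) simp
  with ev eventually_ln_large eventually_ge_at_top[of 1] show ?thesis
  proof eventually_elim
    case (elim n)
    have p: "p n > 0" using p_range elim by auto
    then have q: "q n > p n / 2" using elim by (simp add: field_simps)
    have "exp 10 \<ge> (1 :: real)" by simp
    then have l: "ln (real n) \<ge> 1" using elim by linarith
    have "ln (real n) ^ 6 = ln (real n) powr 6" using l by simp
    also have "\<dots> \<le> ln (real n) powr \<beta>" using l \<beta> by (intro powr_mono) auto
    also have "\<dots> \<le> n * p n" using elim by (simp add: field_simps)
    also have "\<dots> \<le> n * (2 * q n)" using q by (intro mult_left_mono) auto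
    finally show ?case using p q by simp
  qed
qed

text \<open>One statement for all three regimes of p: the gap is (n - 2) / n * (1 - q) up to a null
  sequence, and q has the same limit as p.\<close>

lemma regular_gap_tendsto:
  fixes p :: "nat \<Rightarrow> real" and d :: "nat \<Rightarrow> nat"
  assumes p_range: "\<And>n. n \<ge> 1 \<Longrightarrow> 0 < p n \<and> p n < 1"
    and p_bounds: "\<exists>\<beta>>6. \<forall>\<^sub>F n in sequentially.
      ln (real n) powr \<beta> / real n \<le> p n \<and> p n < 1 - ln (real n) powr \<beta> / real n"
    and d: "\<And>n. n \<ge> 1 \<Longrightarrow> d n \<le> n - 1 \<and> even (n * d n)"
    and lim: "(\<lambda>n. (real (d n) / real n) / p n) \<longlonglongrightarrow> 1"
    and p: "p \<longlonglongrightarrow> l"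
  shows "(\<lambda>n. eigenvalue_gap n (can_regular n (d n)) (mic_regular n (d n))) \<longlonglongrightarrow> 1 - l"
proof -
  define q where "q n = real (d n) / (real n - 1)" for n
  define F where "F n = (real n - 2) / n * (1 - q n)" for n
  \<comment> \<open>The hypothesis compares p with d / n, while the retention probability is d / (n
    - 1).\<close>
  have "(\<lambda>n. (real (d n) / real n) / p n * (real n / (real n - 1))) \<longlonglongrightarrow> 1 * 1"
    by (intro tendsto_mult lim) real_asymp
  moreover have "\<forall>\<^sub>F n in sequentially.
      (real (d n) / real n) / p n * (real n / (real n - 1)) = q n / p n"
    using eventually_ge_at_top[of 1] by eventually_elim (simp add: q_def)
  ultimately have qp: "(\<lambda>n. q n / p n) \<longlonglongrightarrow> 1"
    using Lim_transform_eventually by fastforce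
  have dense: "\<forall>\<^sub>F n in sequentially. 0 < q n \<and> ln (real n) ^ 6 / 2 \<le> n * q n"
    by (rule eventually_dense[OF p_range p_bounds qp])
  have "(\<lambda>n. q n / p n * p n) \<longlonglongrightarrow> 1 * l"
    by (intro tendsto_mult qp p)
  moreover have "\<forall>\<^sub>F n in sequentially. q n / p n * p n = q n"
    using eventually_ge_at_top[of 1]
  proof eventually_elim
    case (elim n)
    then show ?case using p_range[of n] by auto
  qed
  ultimately have ql: "q \<longlonglongrightarrow> l"
    using Lim_transform_eventually by fastforce
  have Fl: "F \<longlonglongrightarrow> 1 * (1 - l)"
    unfolding F_def by (intro tendsto_mult tendsto_diff ql tendsto_const) real_asymp
  have "(\<lambda>n. eigenvalue_gap n (can_regular n (d n)) (mic_regular n (d n)) - F n) \<longlonglongrightarrow> 0"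
  proof (rule Lim_null_comparison[OF _ eigenvalue_err_tendsto_0])
    show "\<forall>\<^sub>F n in sequentially.
        norm (eigenvalue_gap n (can_regular n (d n)) (mic_regular n (d n)) - F n) \<le> eigenvalue_err n"
      using dense eventually_ln_large eventually_ge_at_top[of 2]
    proof eventually_elim
      case (elim n)
      have dn: "d n \<le> n - 1" "even (n * d n)" using d[of n] elim by auto
      have q1: "q n \<le> 1" using dn elim by (simp add: q_def of_nat_diff divide_le_eq)
      \<comment> \<open>The leading term of the canonical expectation is exactly the microcanonical
        eigenvalue d, so the two cancel without remainder.\<close>
      have "q n * (real n - 1) = d n" using elim by (simp add: q_def of_nat_diff)
      then show ?case
        using expected_largest_eigenvalue_erdos_renyi[of n "q n"] elim q1 dn
          can_regular_eq_erdos_renyi[of n "d n"] expectation_mic_regular[of n "d n"]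
        by (simp add: eigenvalue_gap_def F_def q_def)
    qed
  qed
  from tendsto_add[OF this Fl] show ?thesis by simp
qed

text \<open>Both laws share the edge probability and hence the leading term q (n - 1). Their
  variance terms differ only through the two-edge probability, so the gap vanishes whether or not q
  converges.\<close>

lemma edges_gap_tendsto:
  fixes p :: "nat \<Rightarrow> real" and L :: "nat \<Rightarrow> nat"
  assumes p_range: "\<And>n. n \<ge> 1 \<Longrightarrow> 0 < p n \<and> p n < 1"
    and p_bounds: "\<exists>\<beta>>6. \<forall>\<^sub>F n in sequentially.
      ln (real n) powr \<beta> / real n \<le> p n \<and> p n < 1 - ln (real n) powr \<beta> / real n"
    and L: "\<And>n. n \<ge> 1 \<Longrightarrow> L n \<le> n choose 2"
    and lim: "(\<lambda>n. (2 * real (L n) / (real n)\<^sup>2) / p n) \<longlonglongrightarrow> 1"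
  shows "(\<lambda>n. eigenvalue_gap n (can_edges n (L n)) (mic_edges n (L n))) \<longlonglongrightarrow> 0"
proof -
  define q where "q n = real (L n) / real (n choose 2)" for n
  have "(\<lambda>n. (2 * real (L n) / (real n)\<^sup>2) / p n * (real n / (real n - 1))) \<longlonglongrightarrow> 1 * 1"
    by (intro tendsto_mult lim) real_asymp
  moreover have "\<forall>\<^sub>F n in sequentially.
      (2 * real (L n) / (real n)\<^sup>2) / p n * (real n / (real n - 1)) = q n / p n"
    using eventually_ge_at_top[of 2]
    by eventually_elim (simp add: q_def real_choose_two power2_eq_square mult_ac)
  ultimately have qp: "(\<lambda>n. q n / p n) \<longlonglongrightarrow> 1"
    using Lim_transform_eventually by fastforce
  have dense: "\<forall>\<^sub>F n in sequentially. 0 < q n \<and> ln (real n) ^ 6 / 2 \<le> n * q n"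
    by (rule eventually_dense[OF p_range p_bounds qp])
  have err: "(\<lambda>n. 2 * eigenvalue_err n + 1 / (real n * (real n - 1) / 2 - 1)) \<longlonglongrightarrow> 2 * 0 + 0"
    by (intro tendsto_add tendsto_mult tendsto_const eigenvalue_err_tendsto_0) real_asymp
  show ?thesis
  proof (rule Lim_null_comparison)
    show "(\<lambda>n. 2 * eigenvalue_err n + 1 / (real n * (real n - 1) / 2 - 1)) \<longlonglongrightarrow> 0"
      using err by simp
    show "\<forall>\<^sub>F n in sequentially. norm (eigenvalue_gap n (can_edges n (L n)) (mic_edges n (L n)))
        \<le> 2 * eigenvalue_err n + 1 / (real n * (real n - 1) / 2 - 1)"
      using dense eventually_ln_large eventually_ge_at_top[of 3]
    proof eventually_elim
      case (elim n)
      define N where "N = n choose 2"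
      define m where "m = L n"
      have Ln: "m \<le> N" using L[of n] elim by (simp add: N_def m_def)
      have N: "real N = real n * (real n - 1) / 2" by (simp add: N_def real_choose_two)
      have "3 * 2 \<le> real n * (real n - 1)" using elim by (intro mult_mono) auto
      then have N3: "real N \<ge> 3" by (simp add: N)
      have q: "q n = m / N" by (simp add: q_def N_def m_def)
      have L1: "1 \<le> m" using elim by (cases "m = 0") (auto simp: q)
      have q1: "q n \<le> 1" using Ln N3 by (simp add: q)
      define x where "x = (real n - 2) / n * (1 - q n)"
      define y where "y = (real n - 2) / n * (1 - real (m - 1) / real (N - 1))"
      \<comment> \<open>Sampling without replacement lowers the conditional probability of a second
        edge from q to q - (1 - q) / (N - 1).\<close>
      have xy: "\<bar>x - y\<bar> \<le> 1 / (real N - 1)"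
      proof -
        have "x - y = (real n - 2) / n * (real (m - 1) / real (N - 1) - q n)"
          by (simp add: x_def y_def right_diff_distrib)
        also have "real (m - 1) / real (N - 1) - q n = - ((1 - q n) / (real N - 1))"
          using L1 N3 by (simp add: q of_nat_diff field_simps)
        finally have "\<bar>x - y\<bar> = (real n - 2) / n * ((1 - q n) / (real N - 1))"
          using elim q1 N3 by (simp add: abs_mult)
        also have "\<dots> \<le> 1 * (1 / (real N - 1))"
          using elim q1 N3 by (intro mult_mono divide_right_mono) auto
        finally show ?thesis by simp
      qed
      have "\<bar>measure_pmf.expectation (erdos_renyi n (q n)) (largest_eigenvalue n)
          - q n * (real n - 1) - x\<bar> \<le> eigenvalue_err n"
        unfolding x_def using elim q1 by (intro expected_largest_eigenvalue_erdos_renyi) auto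
      moreover have "\<bar>measure_pmf.expectation (mic_edges n m) (largest_eigenvalue n)
          - q n * (real n - 1) - y\<bar> \<le> eigenvalue_err n"
        unfolding y_def N_def using elim L1 Ln
        by (intro expected_largest_eigenvalue_mic_edges) (auto simp: q N_def)
      moreover have "can_edges n m = erdos_renyi n (q n)"
        using can_edges_eq_erdos_renyi[of n m] elim Ln by (simp add: q N_def)
      ultimately show ?case
        using xy unfolding N[symmetric] m_def[symmetric]
        by (simp add: eigenvalue_gap_def abs_le_iff)
    qed
  qed
qed

theorem theorem1p2:
  fixes p :: "nat \<Rightarrow> real"
  assumes p_range: "\<And>n. n \<ge> 1 \<Longrightarrow> 0 < p n \<and> p n < 1"
    and p_bounds: "\<exists>\<beta>>6. \<forall>\<^sub>F n in sequentially.
      ln (real n) powr \<beta> / real n \<le> p n \<and> p n < 1 - ln (real n) powr \<beta> / real n"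
  shows
    "(\<forall>d :: nat \<Rightarrow> nat.
        (\<forall>n\<ge>1. d n \<in> {0..n - 1} \<and> even (n * d n)) \<and>
        (\<lambda>n. (real (d n) / real n) / p n) \<longlonglongrightarrow> 1 \<longrightarrow>
        (\<forall>p0. 0 < p0 \<and> p0 < 1 \<and> (\<forall>n\<ge>1. p n = p0) \<longrightarrow>
           (\<lambda>n. eigenvalue_gap n (can_regular n (d n)) (mic_regular n (d n))) \<longlonglongrightarrow> 1 - p0) \<and>
        (p \<longlonglongrightarrow> 0 \<longrightarrow>
           (\<lambda>n. eigenvalue_gap n (can_regular n (d n)) (mic_regular n (d n))) \<longlonglongrightarrow> 1) \<and>
        (p \<longlonglongrightarrow> 1 \<longrightarrow>
           (\<lambda>n. eigenvalue_gap n (can_regular n (d n)) (mic_regular n (d n))) \<longlonglongrightarrow> 0))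
     \<and>
     (\<forall>L :: nat \<Rightarrow> nat.
        (\<forall>n\<ge>1. L n \<in> {0..n choose 2}) \<and>
        (\<lambda>n. (2 * real (L n) / (real n)\<^sup>2) / p n) \<longlonglongrightarrow> 1 \<longrightarrow>
        (\<lambda>n. eigenvalue_gap n (can_edges n (L n)) (mic_edges n (L n))) \<longlonglongrightarrow> 0)"
proof (intro conjI allI impI; elim conjE)
  fix d :: "nat \<Rightarrow> nat"
  assume d: "\<forall>n\<ge>1. d n \<in> {0..n - 1} \<and> even (n * d n)"
    and lim: "(\<lambda>n. (real (d n) / real n) / p n) \<longlonglongrightarrow> 1"
  have gap: "(\<lambda>n. eigenvalue_gap n (can_regular n (d n)) (mic_regular n (d n))) \<longlonglongrightarrow> 1 - l"
    if "p \<longlonglongrightarrow> l" for l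
    by (rule regular_gap_tendsto[OF p_range p_bounds _ lim that]) (use d in auto)
  show "(\<lambda>n. eigenvalue_gap n (can_regular n (d n)) (mic_regular n (d n))) \<longlonglongrightarrow> 1 - p0"
    if "\<forall>n\<ge>1. p n = p0" for p0
  proof (rule gap)
    \<comment> \<open>The value p 0 is unconstrained, so p is constant only from 1 on.\<close>
    have "\<forall>\<^sub>F n in sequentially. p n = p0"
      using eventually_ge_at_top[of 1] by eventually_elim (use that in auto)
    then show "p \<longlonglongrightarrow> p0" by (rule tendsto_eventually)
  qed
  show "(\<lambda>n. eigenvalue_gap n (can_regular n (d n)) (mic_regular n (d n))) \<longlonglongrightarrow> 1" if "p \<longlonglongrightarrow> 0"
    using gap[OF that] by simp
  show "(\<lambda>n. eigenvalue_gap n (can_regular n (d n)) (mic_regular n (d n))) \<longlonglongrightarrow> 0" if "p \<longlonglongrightarrow> 1"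
    using gap[OF that] by simp
next
  fix L :: "nat \<Rightarrow> nat"
  assume L: "\<forall>n\<ge>1. L n \<in> {0..n choose 2}"
    and lim: "(\<lambda>n. (2 * real (L n) / (real n)\<^sup>2) / p n) \<longlonglongrightarrow> 1"
  show "(\<lambda>n. eigenvalue_gap n (can_edges n (L n)) (mic_edges n (L n))) \<longlonglongrightarrow> 0"
    by (rule edges_gap_tendsto[OF p_range p_bounds _ lim]) (use L in auto)
qed

end
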